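(* Let $\alpha>0$ and let $G$ be a nilpotent subgroup of $\mathrm{Homeo}_+(\mathbb{R})$ all of whose elements are of class $C^{1+\alpha}$. Then there exists a nonzero $G$-invariant Radon measure on $\mathbb{R}$, and there exists a nonempty minimal closed $G$-invariant subset of $\mathbb{R}$.
   Context: $\mathrm{Homeo}_+(\mathbb{R})$ is the group of orientation preserving homeomorphisms of $\mathbb{R}$. $G$ is not assumed finitely generated or countable. Since $G$ is a group, every element of $G$ is a $C^{1+\alpha}$ diffeomorphism of $\mathbb{R}$. For $0<\alpha\le 1$, class $C^{1+\alpha}$ means $C^1$ with locally $\alpha$-Hölder continuous derivative; for $\alpha>1$, write $1+\alpha=k+r$ with $k\geq 1$ an integer and $0<r\le 1$, and $C^{1+\alpha}$ means $C^k$ with locally $r$-Hölder $k$-th derivative. Radon measure: a Borel measure on $\mathbb{R}$ that is finite on every compact set. It is $G$-invariant if $\mu(g(E))=\mu(E)$ for all $g\in G$ and Borel $E$. A minimal closed $G$-invariant set is a nonempty $G$-invariant closed subset of $\mathbb{R}$ that is minimal with respect to inclusion among all nonempty $G$-invariant closed subsets. *)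

theory Defs
  imports "HOL-Analysis.Analysis" "HOL-Algebra.Generated_Groups"
begin

section \<open>Nilpotent groups\<close>

primrec lower_central :: "('a, 'b) monoid_scheme \<Rightarrow> nat \<Rightarrow> 'a set" where
  "lower_central G 0 = carrier G"
| "lower_central G (Suc n) = generate G
     (\<Union>g \<in> carrier G. \<Union>h \<in> lower_central G n.
        {g \<otimes>\<^bsub>G\<^esub> h \<otimes>\<^bsub>G\<^esub> (inv\<^bsub>G\<^esub> g) \<otimes>\<^bsub>G\<^esub> (inv\<^bsub>G\<^esub> h)})"

definition nilpotent_group :: "('a, 'b) monoid_scheme \<Rightarrow> bool" where
  "nilpotent_group G \<longleftrightarrow> group G \<and> (\<exists>n. lower_central G n = {\<one>\<^bsub>G\<^esub>})"


section \<open>Orientation preserving homeomorphisms of the line\<close>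

text \<open>A homeomorphism of the line preserves orientation iff it is increasing.\<close>

definition Homeo_plus :: "(real \<Rightarrow> real) monoid" where
  "Homeo_plus = \<lparr>carrier = {f. (\<exists>g. homeomorphism UNIV UNIV f g) \<and> strict_mono f},
                 mult = (\<circ>), one = id\<rparr>"

lemma group_Homeo_plus: "group Homeo_plus"
proof (rule groupI)
  fix f g assume "f \<in> carrier Homeo_plus" "g \<in> carrier Homeo_plus"
  then obtain f' g' where "homeomorphism UNIV UNIV f f'" "strict_mono f"
      "homeomorphism UNIV UNIV g g'" "strict_mono g"
    by (auto simp: Homeo_plus_def)
  then have "homeomorphism UNIV UNIV (f \<circ> g) (g' \<circ> f')" "strict_mono (f \<circ> g)"
    by (auto intro: homeomorphism_compose strict_mono_o)
  then show "f \<otimes>\<^bsub>Homeo_plus\<^esub> g \<in> carrier Homeo_plus"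
    by (auto simp: Homeo_plus_def)
next
  show "\<one>\<^bsub>Homeo_plus\<^esub> \<in> carrier Homeo_plus"
    by (auto simp: Homeo_plus_def strict_mono_def homeomorphism_def intro!: exI[of _ id])
next
  fix f assume "f \<in> carrier Homeo_plus"
  then obtain g where h: "homeomorphism UNIV UNIV f g" and m: "strict_mono f"
    by (auto simp: Homeo_plus_def)
  have gf: "g (f x) = x" and fg: "f (g x) = x" for x
    using h by (auto simp: homeomorphism_def)
  have "strict_mono g"
    by (rule strict_monoI) (metis fg m strict_mono_less)
  then have "g \<in> carrier Homeo_plus"
    using h by (auto simp: Homeo_plus_def intro: homeomorphism_symD)
  moreover have "g \<otimes>\<^bsub>Homeo_plus\<^esub> f = \<one>\<^bsub>Homeo_plus\<^esub>"
    using gf by (auto simp: Homeo_plus_def)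
  ultimately show "\<exists>y\<in>carrier Homeo_plus. y \<otimes>\<^bsub>Homeo_plus\<^esub> f = \<one>\<^bsub>Homeo_plus\<^esub>"
    by blast
qed (auto simp: Homeo_plus_def)


section \<open>Differentiability classes\<close>

definition locally_Hoelder :: "real \<Rightarrow> (real \<Rightarrow> real) \<Rightarrow> bool" where
  "locally_Hoelder r f \<longleftrightarrow>
     (\<forall>x. \<exists>e>0. \<exists>C. \<forall>y\<in>ball x e. \<forall>z\<in>ball x e. \<bar>f y - f z\<bar> \<le> C * \<bar>y - z\<bar> powr r)"

definition class_C :: "nat \<Rightarrow> (real \<Rightarrow> real) \<Rightarrow> bool" where
  "class_C k f \<longleftrightarrow>
     (\<forall>i<k. (deriv ^^ i) f differentiable_on UNIV) \<and> continuous_on UNIV ((deriv ^^ k) f)"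

text \<open>Class \<open>C\<^sup>1\<^sup>+\<^sup>\<alpha>\<close>. For \<open>\<alpha> > 0\<close> the decomposition \<open>1 + \<alpha> = k + r\<close> with \<open>k \<ge> 1\<close> and
  \<open>0 < r \<le> 1\<close> exists and is unique; for \<open>\<alpha> \<le> 1\<close> it is \<open>k = 1\<close>, \<open>r = \<alpha>\<close>.\<close>

definition class_C_1_plus :: "real \<Rightarrow> (real \<Rightarrow> real) \<Rightarrow> bool" where
  "class_C_1_plus \<alpha> f \<longleftrightarrow>
     (\<exists>k r. 1 \<le> k \<and> 0 < r \<and> r \<le> 1 \<and> 1 + \<alpha> = real k + r \<and>
        class_C k f \<and> locally_Hoelder r ((deriv ^^ k) f))"


section \<open>Invariant measures and minimal sets\<close>

definition Radon_measure :: "real measure \<Rightarrow> bool" where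
  "Radon_measure \<mu> \<longleftrightarrow> sets \<mu> = sets borel \<and> (\<forall>K. compact K \<longrightarrow> emeasure \<mu> K < \<infinity>)"

definition invariant_measure :: "(real \<Rightarrow> real) set \<Rightarrow> real measure \<Rightarrow> bool" where
  "invariant_measure G \<mu> \<longleftrightarrow> (\<forall>g\<in>G. \<forall>E\<in>sets borel. emeasure \<mu> (g ` E) = emeasure \<mu> E)"

definition closed_invariant :: "(real \<Rightarrow> real) set \<Rightarrow> real set \<Rightarrow> bool" where
  "closed_invariant G K \<longleftrightarrow> closed K \<and> K \<noteq> {} \<and> (\<forall>g\<in>G. g ` K = K)"

definition minimal_closed_invariant :: "(real \<Rightarrow> real) set \<Rightarrow> real set \<Rightarrow> bool" where
  "minimal_closed_invariant G K \<longleftrightarrow>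
     closed_invariant G K \<and> (\<forall>L. closed_invariant G L \<and> L \<subseteq> K \<longrightarrow> L = K)"

end

theory Submission
  imports Defs
begin

text \<open>
  If \<open>G\<close> has a global fixed point, a Dirac mass and a singleton do. Otherwise there are two cases.

  Suppose some element of \<open>G\<close> has no fixed point. A nilpotent group satisfies a law equating two
  different positive words (of Thue--Morse type) in two letters, so its elements cannot play ping-pong.
  Hence the elements with a fixed point form a normal subgroup, modulo which \<open>G\<close> is an Archimedean
  ordered group; by Hoelder's argument it embeds in the reals, which yields a monotone function \<open>\<phi>\<close> with
  \<open>\<phi> (g x) - \<phi> x\<close> independent of \<open>x\<close>. Its Stieltjes measure is invariant. A minimal set exists
  because every orbit meets a compact interval.

  Suppose every element has a fixed point. Let \<open>H\<close> be the last term of the lower central series without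
  a global fixed point and \<open>F\<close> the fixed set of the next term; \<open>H\<close> acts on \<open>F\<close> as an abelian group.
  Adjacent fixed points of elements of \<open>H\<close> produce arbitrarily many nested levels of intervals, so
  the smallest interval has disjoint images indexed by \<open>\<nat>\<^sup>d\<close> inside a bounded set. For \<open>d \<ge> 2 / \<alpha>\<close>
  an average over discrete line segments finds arbitrarily long paths along which the sum of the
  \<open>\<alpha>\<close>-th powers of the lengths is bounded, hence compositions of bounded distortion that shrink the interval
  arbitrarily. As in Kopell's lemma this contradicts the presence of a nontrivial element that
  commutes with them.
\<close>

section \<open>Groups acting on the line\<close>

abbreviation finv :: "(real \<Rightarrow> real) \<Rightarrow> real \<Rightarrow> real" where "finv \<equiv> inv_into UNIV"

locale line_group =
  fixes G :: "(real \<Rightarrow> real) set"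
  assumes id_mem: "id \<in> G"
    and comp_mem: "g \<in> G \<Longrightarrow> h \<in> G \<Longrightarrow> g \<circ> h \<in> G"
    and inv_mem: "g \<in> G \<Longrightarrow> finv g \<in> G"
    and strict_mono_mem: "g \<in> G \<Longrightarrow> strict_mono g"
    and continuous_mem: "g \<in> G \<Longrightarrow> continuous_on UNIV g"
    and surj_mem: "g \<in> G \<Longrightarrow> surj g"
begin

lemma bij_mem: "g \<in> G \<Longrightarrow> bij g"
  by (simp add: bij_betw_def strict_mono_imp_inj_on strict_mono_mem surj_mem)

lemma inv_app: "g \<in> G \<Longrightarrow> finv g (g x) = x"
  by (simp add: bij_mem bij_is_inj)

lemma app_inv: "g \<in> G \<Longrightarrow> g (finv g x) = x"
  by (simp add: surj_f_inv_f surj_mem)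

lemma less_iff: "g \<in> G \<Longrightarrow> g x < g y \<longleftrightarrow> x < y"
  by (simp add: strict_mono_less strict_mono_mem)

lemma le_iff: "g \<in> G \<Longrightarrow> g x \<le> g y \<longleftrightarrow> x \<le> y"
  by (simp add: strict_mono_less_eq strict_mono_mem)

lemma eq_iff: "g \<in> G \<Longrightarrow> g x = g y \<longleftrightarrow> x = y"
  by (simp add: strict_mono_eq strict_mono_mem)

lemma inv_less_iff: "g \<in> G \<Longrightarrow> finv g x < y \<longleftrightarrow> x < g y"
  using less_iff[of g "finv g x" y] by (simp add: app_inv)

lemma less_inv_iff: "g \<in> G \<Longrightarrow> x < finv g y \<longleftrightarrow> g x < y"
  using less_iff[of g x "finv g y"] by (simp add: app_inv)

lemma inv_le_iff: "g \<in> G \<Longrightarrow> finv g x \<le> y \<longleftrightarrow> x \<le> g y"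
  using le_iff[of g "finv g x" y] by (simp add: app_inv)

lemma le_inv_iff: "g \<in> G \<Longrightarrow> x \<le> finv g y \<longleftrightarrow> g x \<le> y"
  using le_iff[of g x "finv g y"] by (simp add: app_inv)

lemma inv_eq_iff: "g \<in> G \<Longrightarrow> finv g x = y \<longleftrightarrow> x = g y"
  using app_inv[of g x] inv_app[of g y] by auto

lemmas group_simps = less_iff le_iff eq_iff inv_less_iff less_inv_iff inv_le_iff le_inv_iff
  inv_eq_iff inv_app app_inv

lemma inv_inv [simp]: "g \<in> G \<Longrightarrow> finv (finv g) = g"
  by (simp add: bij_mem inv_inv_eq)

lemma funpow_mem: "g \<in> G \<Longrightarrow> g ^^ n \<in> G"
  by (induction n) (simp_all add: id_mem comp_mem)

lemma isCont_mem: "g \<in> G \<Longrightarrow> isCont g x"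
  using continuous_mem continuous_on_eq_continuous_at open_UNIV by blast

lemma fixed_between:
  assumes "g \<in> G" "p \<le> q" "p \<le> g p" "g q \<le> q"
  shows "\<exists>x. p \<le> x \<and> x \<le> q \<and> g x = x"
proof -
  have "continuous_on {p..q} (\<lambda>x. x - g x)"
    by (intro continuous_intros continuous_on_subset[OF continuous_mem[OF assms(1)]]) auto
  then have "\<exists>x. p \<le> x \<and> x \<le> q \<and> x - g x = 0"
    using assms by (intro IVT') auto
  then show ?thesis by force
qed

lemma funpow_tendsto_fixed:
  assumes g: "g \<in> G" and l: "(\<lambda>n. (g ^^ n) x) \<longlonglongrightarrow> l"
  shows "g l = l"
proof -
  have "(\<lambda>n. g ((g ^^ n) x)) \<longlonglongrightarrow> g l"
    using isCont_mem[OF g] l by (rule isCont_tendsto_compose)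
  then have "(\<lambda>n. (g ^^ Suc n) x) \<longlonglongrightarrow> g l" by simp
  moreover have "(\<lambda>n. (g ^^ Suc n) x) \<longlonglongrightarrow> l"
    using l by (rule LIMSEQ_Suc)
  ultimately show ?thesis using LIMSEQ_unique by blast
qed

lemma funpow_decreasing:
  assumes "g \<in> G" "g x \<le> x"
  shows "decseq (\<lambda>n. (g ^^ n) x)"
proof (rule decseq_SucI)
  fix n
  have "(g ^^ n) (g x) \<le> (g ^^ n) x"
    using assms by (simp add: le_iff[OF funpow_mem])
  then show "(g ^^ Suc n) x \<le> (g ^^ n) x" by (simp add: funpow_swap1)
qed

lemma funpow_increasing:
  assumes "g \<in> G" "x \<le> g x"
  shows "incseq (\<lambda>n. (g ^^ n) x)"
proof (rule incseq_SucI)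
  fix n
  have "(g ^^ n) x \<le> (g ^^ n) (g x)"
    using assms by (simp add: le_iff[OF funpow_mem])
  then show "(g ^^ n) x \<le> (g ^^ Suc n) x" by (simp add: funpow_swap1)
qed

text \<open>An orbit staying above \<open>c\<close> would decrease to a limit in
  \<open>{c..b}\<close>, which would be a fixed point.\<close>

lemma funpow_eventually_below:
  assumes g: "g \<in> G" and below: "\<And>x. c \<le> x \<Longrightarrow> x \<le> b \<Longrightarrow> g x < x"
  shows "\<exists>n. (g ^^ n) b < c"
proof (rule ccontr)
  assume "\<not> ?thesis"
  then have ge: "c \<le> (g ^^ n) b" for n by (simp add: not_less)
  have "g b \<le> b" using below[of b] ge[of 0] by simp
  then have dec: "decseq (\<lambda>n. (g ^^ n) b)" by (rule funpow_decreasing[OF g])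
  then obtain l where l: "(\<lambda>n. (g ^^ n) b) \<longlonglongrightarrow> l" and "\<forall>n. l \<le> (g ^^ n) b"
    using decseq_convergent[OF dec, of c] ge by auto
  then have "l \<le> b" by (metis funpow_0)
  moreover have "c \<le> l" using l ge by (intro LIMSEQ_le_const) auto
  ultimately have "g l < l" by (intro below)
  then show False using funpow_tendsto_fixed[OF g l] by simp
qed

lemma funpow_eventually_above:
  assumes g: "g \<in> G" and above: "\<And>x. b \<le> x \<Longrightarrow> x \<le> c \<Longrightarrow> x < g x"
  shows "\<exists>n. c < (g ^^ n) b"
proof (rule ccontr)
  assume "\<not> ?thesis"
  then have le: "(g ^^ n) b \<le> c" for n by (simp add: not_less)
  have "b \<le> g b" using above[of b] le[of 0] by simp
  then have inc: "incseq (\<lambda>n. (g ^^ n) b)" by (rule funpow_increasing[OF g])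
  then obtain l where l: "(\<lambda>n. (g ^^ n) b) \<longlonglongrightarrow> l" and "\<forall>n. (g ^^ n) b \<le> l"
    using incseq_convergent[OF inc, of c] le by auto
  then have "b \<le> l" by (metis funpow_0)
  moreover have "l \<le> c" using l le by (intro LIMSEQ_le_const2) auto
  ultimately have "l < g l" by (intro above)
  then show False using funpow_tendsto_fixed[OF g l] by simp
qed

end

section \<open>Groups without ping-pong pairs\<close>

locale no_ping_pong = line_group +
  assumes no_ping_pong: "u \<in> G \<Longrightarrow> v \<in> G \<Longrightarrow> J \<noteq> {} \<Longrightarrow> u ` J \<subseteq> J \<Longrightarrow> v ` J \<subseteq> J \<Longrightarrow> u ` J \<inter> v ` J \<noteq> {}"
begin

text \<open>Between \<open>p\<close> and \<open>q\<close> there are a fixed point \<open>a\<close>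
  of \<open>u\<close> and a fixed point \<open>b\<close> of \<open>v\<close> such that high powers
  of \<open>u\<close> and of \<open>finv v\<close> contract \<open>{a..b}\<close> towards opposite
  ends, which is a ping-pong pair.\<close>

lemma nonneg_comp_aux:
  assumes u: "u \<in> G" and v: "v \<in> G" and neg: "\<And>z. u (v z) < z"
    and p: "p \<le> u p" and q: "q \<le> v q" and "p \<le> q"
  shows False
proof -
  have "u q < q" using q neg[of q] le_iff[OF u, of q "v q"] by linarith
  define A where "A = {x \<in> {p..q}. u x = x}"
  have cl: "closed {x. g x = x}" if "g \<in> G" for g
    using continuous_mem[OF that] by (intro closed_Collect_eq continuous_intros)
  have "A = {x. u x = x} \<inter> {p..q}" by (auto simp: A_def)
  then have "compact A" using cl[OF u] by (simp add: closed_Int_compact)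
  moreover have "A \<noteq> {}" using fixed_between[OF u \<open>p \<le> q\<close> p] \<open>u q < q\<close> by (auto simp: A_def)
  ultimately obtain a where a: "a \<in> A" and amax: "\<And>x. x \<in> A \<Longrightarrow> x \<le> a"
    by (meson compact_attains_sup)
  have ua: "u a = a" and aq: "p \<le> a" "a \<le> q" using a by (auto simp: A_def)
  have va: "v a < a" using neg[of a] ua less_iff[OF u, of "v a" a] by simp
  have uless: "u x < x" if "a < x" "x \<le> q" for x
  proof (rule ccontr)
    assume "\<not> u x < x"
    then obtain y where "x \<le> y" "y \<le> q" "u y = y"
      using fixed_between[OF u \<open>x \<le> q\<close>] \<open>u q < q\<close> by fastforce
    then have "y \<in> A" using that aq by (auto simp: A_def)
    then show False using amax[of y] that \<open>x \<le> y\<close> by simp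
  qed
  define B where "B = {x \<in> {a..q}. v x = x}"
  have "B = {x. v x = x} \<inter> {a..q}" by (auto simp: B_def)
  then have "compact B" using cl[OF v] by (simp add: closed_Int_compact)
  moreover have "B \<noteq> {}"
  proof -
    \<comment> \<open>\<open>v\<close> lowers \<open>a\<close> and does not lower \<open>q\<close>,
      so \<open>fixed_between\<close> applies to its inverse.\<close>
    have "\<exists>x. a \<le> x \<and> x \<le> q \<and> finv v x = x"
      using aq va q by (intro fixed_between inv_mem v) (auto simp: group_simps[OF v])
    then show ?thesis unfolding B_def by (auto simp: group_simps[OF v])
  qed
  ultimately obtain b where b: "b \<in> B" and bmin: "\<And>x. x \<in> B \<Longrightarrow> b \<le> x"
    by (meson compact_attains_inf)
  have vb: "v b = b" and ab: "a \<le> b" "b \<le> q" using b by (auto simp: B_def)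
  have "a < b" using va vb ab(1) by (cases "a = b") auto
  have v'less: "x < finv v x" if "a \<le> x" "x < b" for x
  proof (rule ccontr)
    assume "\<not> x < finv v x"
    then have "x \<le> v x" by (simp add: group_simps[OF v] not_less)
    then have "\<exists>y. a \<le> y \<and> y \<le> x \<and> finv v y = y"
      using that va by (intro fixed_between inv_mem v) (auto simp: group_simps[OF v])
    then obtain y where "a \<le> y" "y \<le> x" "v y = y" by (auto simp: inv_eq_iff[OF v])
    then have "y \<in> B" using that ab by (auto simp: B_def)
    then show False using bmin[of y] that \<open>y \<le> x\<close> by simp
  qed
  define c where "c = (a + b) / 2"
  have c: "a < c" "c < b" using \<open>a < b\<close> by (auto simp: c_def)
  obtain n where n: "(u ^^ n) b < c"
    using funpow_eventually_below[OF u, of c b] uless c ab by fastforce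
  obtain m where m: "c < (finv v ^^ m) a"
    using funpow_eventually_above[OF inv_mem[OF v], of a c] v'less c ab by fastforce
  let ?u = "u ^^ n" and ?v = "finv v ^^ m"
  have uG: "?u \<in> G" and vG: "?v \<in> G" using u v by (auto intro: funpow_mem inv_mem)
  have ua': "?u a = a" by (induction n) (auto simp: ua)
  have "finv v b = b" using vb by (simp add: inv_eq_iff[OF v])
  then have vb': "?v b = b" by (induction m) auto
  have "?u ` {a..b} \<inter> ?v ` {a..b} \<noteq> {}"
  proof (rule no_ping_pong[OF uG vG])
    show "?u ` {a..b} \<subseteq> {a..b}"
    proof (rule image_subsetI)
      fix x assume "x \<in> {a..b}"
      then have "?u a \<le> ?u x" "?u x \<le> ?u b" by (auto simp: le_iff[OF uG])
      then show "?u x \<in> {a..b}" using ua' n c by auto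
    qed
    show "?v ` {a..b} \<subseteq> {a..b}"
    proof (rule image_subsetI)
      fix x assume "x \<in> {a..b}"
      then have "?v a \<le> ?v x" "?v x \<le> ?v b" by (auto simp: le_iff[OF vG])
      then show "?v x \<in> {a..b}" using vb' m c by auto
    qed
  qed (use ab in auto)
  then obtain x y where xy: "x \<in> {a..b}" "y \<in> {a..b}" "?u x = ?v y" by blast
  have "?u x \<le> ?u b" using xy le_iff[OF uG, of x b] by simp
  moreover have "?v a \<le> ?v y" using xy le_iff[OF vG, of a y] by simp
  ultimately show False using xy n m by simp
qed

text \<open>Otherwise \<open>u \<circ> v\<close> lies strictly below the identity, and so does its
  conjugate \<open>v \<circ> u\<close>; hence \<open>nonneg_comp_aux\<close> covers either order of
  \<open>p\<close> and \<open>q\<close>. Transitivity of \<open>\<preceq>\<close> below rests on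
  this.\<close>

lemma nonneg_comp:
  assumes u: "u \<in> G" and v: "v \<in> G" and p: "p \<le> u p" and q: "q \<le> v q"
  shows "\<exists>z. z \<le> u (v z)"
proof (rule ccontr)
  assume "\<not> ?thesis"
  then have neg: "u (v z) < z" for z by (simp add: not_le)
  have neg': "v (u z) < z" for z
    using neg[of "finv v z"] by (simp add: group_simps[OF v])
  show False
    using nonneg_comp_aux[OF u v neg p q] nonneg_comp_aux[OF v u neg' q p] by linarith
qed

end

section \<open>Invariant measures from functions that the group shifts by constants\<close>

lemma interval_measure_image:
  assumes mono: "\<And>x y. x \<le> y \<Longrightarrow> F x \<le> F y" and cont: "\<And>a. continuous (at_right a) F"
    and g: "homeomorphism UNIV UNIV g g'" "strict_mono g" and shift: "\<And>x. F (g x) = F x + c"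
    and E: "E \<in> sets borel"
  shows "emeasure (interval_measure F) (g ` E) = emeasure (interval_measure F) E"
proof -
  let ?M = "interval_measure F"
  have inv: "g' (g x) = x" "g (g' x) = x" for x
    using g(1) by (auto simp: homeomorphism_def)
  have img: "g' -` E = g ` E" for E
  proof (rule Set.set_eqI, rule iffI)
    fix x assume "x \<in> g' -` E"
    then have "g (g' x) \<in> g ` E" by blast
    then show "x \<in> g ` E" by (simp add: inv)
  qed (auto simp: inv)
  have meas: "g' \<in> measurable ?M borel"
    using g(1) by (simp add: homeomorphism_def borel_measurable_continuous_onI cong: measurable_cong_sets)
  \<comment> \<open>It suffices to compare the measures on half-open intervals, a generating system
    closed under intersection; there the shift \<open>c\<close> cancels.\<close>
  have "distr ?M borel g' = ?M"
  proof (rule measure_eqI_generator_eq)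
    let ?E = "range (\<lambda>(a, b). {a <.. b::real})"
    have Ioc: "emeasure (distr ?M borel g') {a<..b} = emeasure ?M {a<..b}" for a b
    proof -
      have "g ` {a<..b} = {g a<..g b}"
      proof (rule Set.set_eqI, rule iffI)
        fix y assume "y \<in> {g a<..g b}"
        then have "g a < g (g' y)" "g (g' y) \<le> g b" by (auto simp: inv)
        then have "g' y \<in> {a<..b}" using g(2) by (simp add: strict_mono_less strict_mono_less_eq)
        then have "g (g' y) \<in> g ` {a<..b}" by blast
        then show "y \<in> g ` {a<..b}" by (simp add: inv)
      qed (use g(2) in \<open>auto simp: strict_mono_less strict_mono_less_eq\<close>)
      then have "emeasure (distr ?M borel g') {a<..b} = emeasure ?M {g a<..g b}"
        by (subst emeasure_distr[OF meas]) (auto simp: img)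
      also have "\<dots> = emeasure ?M {a<..b}"
        using g(2) by (simp add: emeasure_interval_measure_Ioc_eq[OF mono cont] shift strict_mono_less_eq)
      finally show ?thesis .
    qed
    show "Int_stable ?E" by (auto simp: Int_stable_def Int_greaterThanAtMost)
    show "?E \<subseteq> Pow UNIV" by simp
    show "emeasure (distr ?M borel g') X = emeasure ?M X" if "X \<in> ?E" for X
      using that Ioc by auto
    show "sets (distr ?M borel g') = sigma_sets UNIV ?E"
      by (simp add: borel_sigma_sets_Ioc)
    show "sets ?M = sigma_sets UNIV ?E"
      by (simp add: borel_sigma_sets_Ioc)
    show "range (\<lambda>n. {- real n<..real n}) \<subseteq> ?E" by auto
    show "(\<Union>n. {- real n<..real n}) = UNIV"
    proof (rule UNIV_eq_I[symmetric])
      fix x :: real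
      obtain n where "\<bar>x\<bar> < real n" using reals_Archimedean2 by blast
      then show "x \<in> (\<Union>n. {- real n<..real n})" by (intro UN_I[of n]) auto
    qed
    show "emeasure (distr ?M borel g') {- real n<..real n} \<noteq> \<infinity>" for n
      by (simp add: Ioc emeasure_interval_measure_Ioc_eq[OF mono cont])
  qed
  then have "emeasure ?M E = emeasure (distr ?M borel g') E" by simp
  also have "\<dots> = emeasure ?M (g ` E)"
    using E by (simp add: emeasure_distr[OF meas] img)
  finally show ?thesis by simp
qed

context line_group
begin

lemma homeomorphism_mem: "g \<in> G \<Longrightarrow> homeomorphism UNIV UNIV g (finv g)"
  by (auto simp: homeomorphism_def continuous_mem inv_mem group_simps surj_mem)

lemma invariant_measureI:
  fixes F :: "real \<Rightarrow> real"
  assumes mono: "\<And>x y. x \<le> y \<Longrightarrow> F x \<le> F y" and cont: "\<And>a. continuous (at_right a) F"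
    and shift: "\<And>g. g \<in> G \<Longrightarrow> \<exists>c. \<forall>x. F (g x) = F x + c" and nonconst: "F a < F b"
  shows "\<exists>\<mu>. Radon_measure \<mu> \<and> emeasure \<mu> UNIV \<noteq> 0 \<and> invariant_measure G \<mu>"
proof (intro exI conjI)
  let ?M = "interval_measure F"
  note Ioc = emeasure_interval_measure_Ioc_eq[of F, OF mono cont]
  have fin: "emeasure ?M K < \<infinity>" if K: "compact K" for K
  proof -
    obtain r where r: "\<And>x. x \<in> K \<Longrightarrow> \<bar>x\<bar> \<le> r"
      using compact_imp_bounded[OF K] by (auto simp: bounded_iff)
    \<comment> \<open>The left end is lowered by 1 because the interval is open there and
      \<open>K\<close> may contain \<open>- r\<close>.\<close>
    then have "K \<subseteq> {- r - 1<..r}" by (force simp: abs_le_iff)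
    then have "emeasure ?M K \<le> emeasure ?M {- r - 1<..r}" by (intro emeasure_mono) auto
    also have "\<dots> < \<infinity>" by (simp add: Ioc)
    finally show ?thesis .
  qed
  then show "Radon_measure ?M" by (simp add: Radon_measure_def)
  have "a \<le> b" using mono[of b a] nonconst by linarith
  then have "0 < emeasure ?M {a<..b}" using nonconst by (simp add: Ioc)
  also have "\<dots> \<le> emeasure ?M UNIV" by (intro emeasure_mono) auto
  finally show "emeasure ?M UNIV \<noteq> 0" by simp
  show "invariant_measure G ?M"
    unfolding invariant_measure_def
  proof (intro ballI)
    fix g and E :: "real set" assume "g \<in> G" "E \<in> sets borel"
    then obtain c where "\<forall>x. F (g x) = F x + c" using shift by blast
    with \<open>g \<in> G\<close> \<open>E \<in> sets borel\<close> show "emeasure ?M (g ` E) = emeasure ?M E"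
      by (intro interval_measure_image[OF mono cont homeomorphism_mem strict_mono_mem]) auto
  qed
qed

text \<open>Zorn's lemma is applied to the complements, so that maximal open sets correspond to
  minimal closed ones. Along a chain the traces on \<open>C\<close> are nested nonempty compact
  sets, hence have a common point.\<close>

lemma minimal_closed_invariant_if_compact_meets:
  assumes C: "compact C" and meets: "\<And>x. \<exists>g\<in>G. g x \<in> C"
  shows "\<exists>K. minimal_closed_invariant G K"
proof -
  let ?A = "{U. closed_invariant G (- U)}"
  have "\<exists>M\<in>?A. \<forall>X\<in>?A. M \<subseteq> X \<longrightarrow> X = M"
  proof (rule subset_Zorn_nonempty)
    have "UNIV \<in> (uminus ` ?A)"
      by (rule image_eqI[of _ _ "{}"]) (auto simp: closed_invariant_def surj_mem)
    then show "?A \<noteq> {}" by auto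
    fix \<C> assume ne: "\<C> \<noteq> {}" and ch: "subset.chain ?A \<C>"
    have ci: "closed_invariant G (- U)" if "U \<in> \<C>" for U
      using ch that by (auto simp: subset_chain_def)
    have "\<Inter> ((\<lambda>U. C - U) ` \<C>) \<noteq> {}"
    proof (rule compact_chain)
      show "compact S" if "S \<in> (\<lambda>U. C - U) ` \<C>" for S
        using that ci C by (auto simp: Diff_eq closed_invariant_def intro!: compact_Int_closed)
      \<comment> \<open>A nonempty invariant set contains an orbit, and every orbit meets
        \<open>C\<close>.\<close>
      show "{} \<notin> (\<lambda>U. C - U) ` \<C>"
      proof
        assume "{} \<in> (\<lambda>U. C - U) ` \<C>"
        then obtain U where U: "U \<in> \<C>" "C \<subseteq> U" by auto
        then obtain x where x: "x \<in> - U" using ci by (force simp: closed_invariant_def)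
        obtain g where "g \<in> G" "g x \<in> C" using meets by blast
        then have "g x \<in> - U" using ci[OF U(1)] x by (auto simp: closed_invariant_def)
        then show False using \<open>g x \<in> C\<close> U by auto
      qed
      show "S \<subseteq> T \<or> T \<subseteq> S" if ST: "S \<in> (\<lambda>U. C - U) ` \<C> \<and> T \<in> (\<lambda>U. C - U) ` \<C>" for S T
      proof -
        obtain U V where "U \<in> \<C>" "V \<in> \<C>" "S = C - U" "T = C - V" using ST by auto
        moreover from this have "U \<subseteq> V \<or> V \<subseteq> U" using ch by (auto simp: subset_chain_def)
        ultimately show ?thesis by blast
      qed
    qed
    then have "- \<Union>\<C> \<noteq> {}" using ne by auto
    moreover have "closed (- \<Union>\<C>)"
      using ci by (auto simp: closed_invariant_def closed_def intro!: open_Union)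
    moreover have "g ` (- \<Union>\<C>) = - \<Union>\<C>" if g: "g \<in> G" for g
    proof -
      have "bij g" by (rule bij_mem[OF g])
      have "g ` (- U) = - U" if "U \<in> \<C>" for U
        using ci[OF that] g by (auto simp: closed_invariant_def)
      then have "g ` U = U" if "U \<in> \<C>" for U
        using that by (metis \<open>bij g\<close> bij_image_Compl_eq boolean_algebra_class.boolean_algebra.double_compl)
      then have "g ` \<Union>\<C> = \<Union>\<C>" by (simp add: image_Union)
      then show ?thesis using \<open>bij g\<close> by (simp add: bij_image_Compl_eq)
    qed
    ultimately show "\<Union>\<C> \<in> ?A" by (simp add: closed_invariant_def)
  qed
  then obtain U where U: "closed_invariant G (- U)"
      and max: "\<And>X. closed_invariant G (- X) \<Longrightarrow> U \<subseteq> X \<Longrightarrow> X = U" by auto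
  have "minimal_closed_invariant G (- U)"
    unfolding minimal_closed_invariant_def
  proof (intro conjI allI impI U)
    fix L assume "closed_invariant G L \<and> L \<subseteq> - U"
    then show "L = - U" using max[of "- L"] by auto
  qed
  then show ?thesis ..
qed

lemma conclusion_if_global_fixed_point:
  assumes p: "\<And>g. g \<in> G \<Longrightarrow> g p = p"
  shows "\<exists>\<mu>. Radon_measure \<mu> \<and> emeasure \<mu> UNIV \<noteq> 0 \<and> invariant_measure G \<mu>"
    and "\<exists>K. minimal_closed_invariant G K"
proof -
  \<comment> \<open>Distribution function of the Dirac mass at \<open>p\<close>; every shift is 0
    because increasing maps fixing \<open>p\<close> preserve both sides of it.\<close>
  let ?F = "\<lambda>x. if p \<le> x then 1 else 0 :: real"
  show "\<exists>\<mu>. Radon_measure \<mu> \<and> emeasure \<mu> UNIV \<noteq> 0 \<and> invariant_measure G \<mu>"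
  proof (rule invariant_measureI)
    show "continuous (at_right a) ?F" for a
    proof (cases "p \<le> a")
      case True
      then have "\<forall>\<^sub>F x in at_right a. ?F x = 1"
        by (auto simp: eventually_at_right_field intro!: exI[of _ "a + 1"])
      then have "(?F \<longlongrightarrow> 1) (at_right a)" by (rule tendsto_eventually)
      then show ?thesis using True by (simp add: continuous_within)
    next
      case False
      then have "\<forall>\<^sub>F x in at_right a. ?F x = 0"
        by (auto simp: eventually_at_right_field intro!: exI[of _ p])
      then have "(?F \<longlongrightarrow> 0) (at_right a)" by (rule tendsto_eventually)
      then show ?thesis using False by (simp add: continuous_within)
    qed
    show "\<exists>c. \<forall>x. ?F (g x) = ?F x + c" if "g \<in> G" for g
      using le_iff[OF that, of p] p[OF that] by (intro exI[of _ 0]) auto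
    show "?F (p - 1) < ?F p" by simp
  qed auto
  have "minimal_closed_invariant G {p}"
    using p by (auto simp: minimal_closed_invariant_def closed_invariant_def)
  then show "\<exists>K. minimal_closed_invariant G K" ..
qed

end

section \<open>Nilpotent groups\<close>

context group
begin

lemma subgroup_lower_central: "subgroup (lower_central G n) G"
proof (induction n)
  case (Suc n)
  then have "lower_central G n \<subseteq> carrier G" by (rule subgroup.subset)
  then show ?case by (auto intro!: generate_is_subgroup)
qed (simp add: subgroup_self)

lemma lower_central_closed: "h \<in> lower_central G n \<Longrightarrow> h \<in> carrier G"
  using subgroup.subset[OF subgroup_lower_central] by blast

lemma commutator_lower_central:
  "g \<in> carrier G \<Longrightarrow> h \<in> lower_central G n \<Longrightarrow>
    g \<otimes> h \<otimes> inv g \<otimes> inv h \<in> lower_central G (Suc n)"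
  by (auto intro: generate.incl)

lemma lower_central_Suc_subset: "lower_central G (Suc n) \<subseteq> lower_central G n"
proof (induction n)
  case 0
  show ?case using lower_central_closed[of _ "Suc 0"] unfolding lower_central.simps(1) by blast
next
  case (Suc n)
  have "lower_central G (Suc (Suc n)) \<subseteq> generate G (\<Union>g \<in> carrier G. \<Union>h \<in> lower_central G n.
        {g \<otimes> h \<otimes> inv g \<otimes> inv h})"
    unfolding lower_central.simps(2)[of G "Suc n"]
    by (rule mono_generate) (use Suc in blast)
  then show ?case by simp
qed

text \<open>Evaluates a positive word whose first letter is \<open>x\<close>; exchanging the
  arguments gives the complementary word, with first letter \<open>y\<close>.\<close>

primrec thue_morse :: "nat \<Rightarrow> 'a \<Rightarrow> 'a \<Rightarrow> 'a" where
  "thue_morse 0 x y = x"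
| "thue_morse (Suc n) x y = thue_morse n x y \<otimes> thue_morse n y x"

lemma thue_morse_closed [simp]:
  "x \<in> carrier G \<Longrightarrow> y \<in> carrier G \<Longrightarrow> thue_morse n x y \<in> carrier G"
  by (induction n arbitrary: x y) auto

text \<open>If \<open>u\<close> and \<open>v\<close> are the two words of level \<open>n\<close>,
  then \<open>u \<otimes> v \<otimes> inv (v \<otimes> u)\<close> is the inverse of the commutator
  of \<open>v\<close> with \<open>u \<otimes> inv v\<close>, so each doubling descends one step in
  the lower central series.\<close>

lemma thue_morse_lower_central:
  assumes "x \<in> carrier G" "y \<in> carrier G"
  shows "thue_morse n x y \<otimes> inv (thue_morse n y x) \<in> lower_central G n"
proof (induction n)
  case (Suc n)
  define u v where "u = thue_morse n x y" and "v = thue_morse n y x"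
  have uv [simp]: "u \<in> carrier G" "v \<in> carrier G" using assms by (auto simp: u_def v_def)
  have "v \<otimes> (u \<otimes> inv v) \<otimes> inv v \<otimes> inv (u \<otimes> inv v) \<in> lower_central G (Suc n)"
    using Suc by (intro commutator_lower_central) (auto simp: u_def[symmetric] v_def[symmetric])
  moreover have "v \<otimes> (u \<otimes> inv v) \<otimes> inv v \<otimes> inv (u \<otimes> inv v) = v \<otimes> u \<otimes> inv v \<otimes> inv u"
    by (simp add: inv_mult_group m_assoc) (simp add: m_assoc[symmetric])
  ultimately have "inv (v \<otimes> u \<otimes> inv v \<otimes> inv u) \<in> lower_central G (Suc n)"
    using subgroup.m_inv_closed[OF subgroup_lower_central] by metis
  moreover have "inv (v \<otimes> u \<otimes> inv v \<otimes> inv u) = u \<otimes> v \<otimes> inv (v \<otimes> u)"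
    by (simp add: inv_mult_group m_assoc)
  ultimately show ?case by (simp add: u_def v_def)
qed (use assms in auto)

lemma thue_morse_law:
  assumes "lower_central G n = {\<one>}" "x \<in> carrier G" "y \<in> carrier G"
  shows "thue_morse n x y = thue_morse n y x"
  using thue_morse_lower_central[OF assms(2,3), of n] assms
  by (simp add: inv_solve_right[symmetric] inv_equality) (metis inv_closed inv_equality inv_inv thue_morse_closed)

end

section \<open>Subgroups of \<open>Homeo_plus\<close> as groups of maps of the line\<close>

locale line_subgroup =
  fixes G :: "(real \<Rightarrow> real) set"
  assumes subgroup: "subgroup G Homeo_plus"
begin

abbreviation grp where "grp \<equiv> Homeo_plus\<lparr>carrier := G\<rparr>"

lemma group_grp: "group grp"
  using subgroup group_Homeo_plus by (simp add: subgroup.subgroup_is_group)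

sublocale line_group G
proof
  interpret subgroup G Homeo_plus by (rule subgroup)
  show "id \<in> G" using one_closed by (simp add: Homeo_plus_def)
  show comp: "g \<circ> h \<in> G" if "g \<in> G" "h \<in> G" for g h
    using m_closed[OF that] by (simp add: Homeo_plus_def)
  have carr: "g \<in> carrier Homeo_plus" if "g \<in> G" for g using subset that by auto
  then show "strict_mono g" "continuous_on UNIV g" if "g \<in> G" for g
    using that by (fastforce simp: Homeo_plus_def homeomorphism_def)+
  show surj: "surj g" if "g \<in> G" for g
    using carr[OF that] by (auto simp: Homeo_plus_def homeomorphism_def)
  show "finv g \<in> G" if "g \<in> G" for g
  proof -
    interpret H: group Homeo_plus by (rule group_Homeo_plus)
    have "inv\<^bsub>Homeo_plus\<^esub> g \<otimes>\<^bsub>Homeo_plus\<^esub> g = \<one>\<^bsub>Homeo_plus\<^esub>"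
      using carr[OF that] by simp
    then have "inv\<^bsub>Homeo_plus\<^esub> g \<circ> g = id" by (simp add: Homeo_plus_def)
    then have "inv\<^bsub>Homeo_plus\<^esub> g = finv g"
      using surj[OF that] by (metis comp_assoc comp_id id_comp surj_iff)
    then show ?thesis using m_inv_closed[OF that] by simp
  qed
qed

lemma inv_grp: "g \<in> G \<Longrightarrow> inv\<^bsub>grp\<^esub> g = finv g"
proof -
  assume g: "g \<in> G"
  interpret K: group grp by (rule group_grp)
  have "finv g \<otimes>\<^bsub>grp\<^esub> g = \<one>\<^bsub>grp\<^esub>"
    using g by (simp add: Homeo_plus_def fun_eq_iff inv_app)
  then show ?thesis using g by (intro K.inv_equality) (auto simp: inv_mem)
qed

lemma mult_grp: "g \<otimes>\<^bsub>grp\<^esub> h = g \<circ> h"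
  by (simp add: Homeo_plus_def)

lemma one_grp: "\<one>\<^bsub>grp\<^esub> = id"
  by (simp add: Homeo_plus_def)

end

locale nilpotent_line_group = line_subgroup +
  assumes nilpotent: "nilpotent_group (Homeo_plus\<lparr>carrier := G\<rparr>)"
begin

text \<open>The Thue-Morse words starting with \<open>u\<close> and with \<open>v\<close> are equal
  maps by nilpotency, and they send \<open>J\<close> into its image under \<open>u\<close> and under
  \<open>v\<close> respectively, so the two images share points.\<close>

sublocale no_ping_pong G
proof
  fix u v :: "real \<Rightarrow> real" and J :: "real set"
  assume uv: "u \<in> G" "v \<in> G" and J: "J \<noteq> {}" "u ` J \<subseteq> J" "v ` J \<subseteq> J"
  interpret K: group grp by (rule group_grp)
  obtain n where n: "lower_central grp n = {\<one>\<^bsub>grp\<^esub>}"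
    using nilpotent by (auto simp: nilpotent_group_def)
  \<comment> \<open>A positive word in maps that send \<open>J\<close> into itself sends
    \<open>J\<close> into the image under its first letter.\<close>
  have img: "K.thue_morse m x y ` J \<subseteq> x ` J" if "x ` J \<subseteq> J" "y ` J \<subseteq> J" for m x y
    using that
  proof (induction m arbitrary: x y)
    case (Suc m)
    have "K.thue_morse (Suc m) x y ` J = K.thue_morse m x y ` (K.thue_morse m y x ` J)"
      by (simp only: K.thue_morse.simps mult_grp image_comp)
    also have "\<dots> \<subseteq> K.thue_morse m x y ` J"
      using Suc.IH[of y x] Suc.prems by (intro image_mono) auto
    also have "\<dots> \<subseteq> x ` J" using Suc by simp
    finally show ?case .
  qed simp
  have "K.thue_morse n u v = K.thue_morse n v u"
    using uv by (intro K.thue_morse_law[OF n]) auto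
  then have "K.thue_morse n u v ` J \<subseteq> u ` J \<inter> v ` J"
    using img[OF J(2,3), of n] img[OF J(3,2), of n] by simp
  then show "u ` J \<inter> v ` J \<noteq> {}" using J(1) by auto
qed

text \<open>Commutators of \<open>G\<close> with the term \<open>H\<close> lie in the next term,
  which fixes \<open>F\<close> pointwise; hence \<open>H\<close> acts on \<open>F\<close> by
  commuting maps. \<open>F\<close> is invariant because the next term is normal.\<close>

lemma central_level:
  assumes nofix: "\<And>x. \<exists>g\<in>G. g x \<noteq> x"
  shows "\<exists>H F. H \<subseteq> G \<and> line_group H \<and> (\<forall>x. \<exists>g\<in>H. g x \<noteq> x) \<and>
    closed F \<and> F \<noteq> {} \<and> (\<forall>g\<in>H. \<forall>x\<in>F. g x \<in> F) \<and>
    (\<forall>g\<in>H. \<forall>h\<in>H. \<forall>x\<in>F. g (h x) = h (g x))"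
proof -
  interpret K: group grp by (rule group_grp)
  let ?\<gamma> = "lower_central grp"
  let ?P = "\<lambda>n. \<exists>x. \<forall>g\<in>?\<gamma> n. g x = x"
  obtain n where n: "?\<gamma> n = {\<one>\<^bsub>grp\<^esub>}"
    using nilpotent by (auto simp: nilpotent_group_def)
  then have Pn: "?P n" by (simp add: one_grp)
  have P0: "\<not> ?P 0" using nofix by auto
  obtain i where i: "\<not> ?P i" "?P (Suc i)"
  proof (rule ccontr)
    assume "\<not> thesis"
    then have step: "\<not> ?P i \<Longrightarrow> \<not> ?P (Suc i)" for i using that by blast
    have "\<not> ?P m" for m
    proof (induction m)
      case (Suc m)
      then show ?case by (rule step)
    qed (rule P0)
    then show False using Pn by blast
  qed
  define H where "H = ?\<gamma> i"
  define F where "F = {x. \<forall>k\<in>?\<gamma> (Suc i). k x = x}"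
  have sub: "g \<in> G" if "g \<in> ?\<gamma> m" for g m using K.lower_central_closed[OF that] by simp
  have comp: "g \<circ> h \<in> ?\<gamma> m" if "g \<in> ?\<gamma> m" "h \<in> ?\<gamma> m" for g h m
    using subgroup.m_closed[OF K.subgroup_lower_central that] by (simp only: mult_grp)
  have HG: "H \<subseteq> G" using sub by (auto simp: H_def)
  have "line_group H"
  proof
    show "id \<in> H" using subgroup.one_closed[OF K.subgroup_lower_central, of i] by (simp only: one_grp H_def)
    show "g \<circ> h \<in> H" if "g \<in> H" "h \<in> H" for g h using comp that by (simp add: H_def)
    show "finv g \<in> H" if "g \<in> H" for g
      using subgroup.m_inv_closed[OF K.subgroup_lower_central, of g i] that sub
      by (simp add: H_def inv_grp del: lower_central.simps)
  qed (use HG strict_mono_mem continuous_mem surj_mem in \<open>blast+\<close>)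
  moreover have "closed F"
  proof -
    have "F = (\<Inter>k\<in>?\<gamma> (Suc i). {x. k x = x})" unfolding F_def by blast
    moreover have "closed {x. k x = x}" if "k \<in> ?\<gamma> (Suc i)" for k
      by (intro closed_Collect_eq continuous_intros continuous_mem[OF sub[OF that]])
    ultimately show ?thesis by auto
  qed
  moreover have comm: "g \<circ> h \<circ> finv g \<circ> finv h \<in> ?\<gamma> (Suc m)" if "g \<in> G" "h \<in> ?\<gamma> m" for g h m
    using K.commutator_lower_central[of g h m] that sub
    by (simp only: mult_grp inv_grp) simp
  have Finv: "g x \<in> F" if g: "g \<in> G" and x: "x \<in> F" for g x
    unfolding F_def
  proof (intro CollectI ballI)
    fix k assume k: "k \<in> ?\<gamma> (Suc i)"
    \<comment> \<open>Normality in commutator form: multiplied by \<open>k\<close> on the right,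
      this commutator becomes the conjugate \<open>finv g \<circ> k \<circ> g\<close>.\<close>
    have "finv g \<circ> k \<circ> finv (finv g) \<circ> finv k \<in> ?\<gamma> (Suc (Suc i))"
      by (rule comm[OF inv_mem[OF g] k])
    then have "finv g \<circ> k \<circ> finv (finv g) \<circ> finv k \<in> ?\<gamma> (Suc i)"
      using K.lower_central_Suc_subset by (rule rev_subsetD)
    then have "finv g \<circ> k \<circ> g \<circ> finv k \<in> ?\<gamma> (Suc i)" by (simp only: inv_inv[OF g])
    then have "finv g \<circ> k \<circ> g \<circ> finv k \<circ> k \<in> ?\<gamma> (Suc i)" using k by (rule comp)
    then have "(finv g \<circ> k \<circ> g \<circ> finv k \<circ> k) x = x" using x unfolding F_def by blast
    then have "finv g (k (g x)) = x" using inv_app[OF sub[OF k]] by simp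
    then show "k (g x) = g x" by (simp add: inv_eq_iff[OF g])
  qed
  moreover have "g (h x) = h (g x)" if "g \<in> H" "h \<in> H" "x \<in> F" for g h x
  proof -
    have gh: "g \<in> G" "h \<in> G" using that HG by auto
    have "g \<circ> h \<circ> finv g \<circ> finv h \<in> ?\<gamma> (Suc i)" using that(2) unfolding H_def by (rule comm[OF gh(1)])
    moreover have "h (g x) \<in> F" by (rule Finv[OF gh(2) Finv[OF gh(1) that(3)]])
    ultimately have "(g \<circ> h \<circ> finv g \<circ> finv h) (h (g x)) = h (g x)" unfolding F_def by blast
    then show ?thesis by (simp add: inv_app[OF gh(1)] inv_app[OF gh(2)])
  qed
  ultimately show ?thesis
  proof (intro exI[of _ H] exI[of _ F] conjI)
    show "\<forall>x. \<exists>g\<in>H. g x \<noteq> x" using i(1) by (auto simp: H_def)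
    show "F \<noteq> {}" using i(2) unfolding F_def by blast
  qed (use HG in blast)+
qed

end

section \<open>Translation numbers\<close>

locale free_element = no_ping_pong +
  fixes f :: "real \<Rightarrow> real"
  assumes f_mem: "f \<in> G" and f_gt: "x < f x"
begin

definition fpow :: "int \<Rightarrow> real \<Rightarrow> real" where
  "fpow k = (if 0 \<le> k then f ^^ nat k else finv f ^^ nat (- k))"

lemma fpow_mem: "fpow k \<in> G"
  by (simp add: fpow_def funpow_mem inv_mem f_mem)

lemma fpow_of_nat [simp]: "fpow (int n) = f ^^ n"
  by (simp add: fpow_def)

lemma fpow_0 [simp]: "fpow 0 = id"
  by (simp add: fpow_def)

lemma fpow_add_1: "fpow (k + 1) x = f (fpow k x)"
proof (cases "0 \<le> k")
  case True
  then show ?thesis by (simp add: fpow_def nat_add_distrib)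
next
  case False
  define m where "m = nat (- (k + 1))"
  have "fpow k = finv f ^^ Suc m" using False by (auto simp: fpow_def m_def Suc_nat_eq_nat_zadd1)
  then have "f (fpow k x) = (finv f ^^ m) x" by (simp add: app_inv[OF f_mem])
  also have "\<dots> = fpow (k + 1) x"
    using False by (cases "k = - 1") (auto simp: fpow_def m_def)
  finally show ?thesis by simp
qed

lemma fpow_add: "fpow (i + j) x = fpow i (fpow j x)"
proof (induction i rule: int_induct[where k = 0])
  case (step1 i)
  then show ?case using fpow_add_1[of "i + j" x] fpow_add_1[of i] by (simp add: add_ac)
next
  case (step2 i)
  have "f (fpow (i - 1 + j) x) = f (fpow (i - 1) (fpow j x))"
    using step2 fpow_add_1[of "i - 1 + j" x] fpow_add_1[of "i - 1"] by (simp add: algebra_simps)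
  then show ?case by (simp add: eq_iff[OF f_mem])
qed simp

lemma funpow_gt: "x < (f ^^ Suc n) x"
  by (induction n) (auto intro: f_gt less_trans)

lemma fpow_less_iff [simp]: "fpow i x < fpow j x \<longleftrightarrow> i < j"
proof -
  have less: "fpow i x < fpow j x" if "i < j" for i j
  proof -
    define n where "n = nat (j - i - 1)"
    have j: "j = int (Suc n) + i" using that by (simp add: n_def)
    have "fpow i x < (f ^^ Suc n) (fpow i x)" by (rule funpow_gt)
    also have "\<dots> = fpow j x" unfolding j fpow_add fpow_of_nat ..
    finally show ?thesis .
  qed
  then show ?thesis by (metis less_asym linorder_neqE)
qed

lemma fpow_le_iff [simp]: "fpow i x \<le> fpow j x \<longleftrightarrow> i \<le> j"
  using fpow_less_iff[of j x i] by (simp add: not_less[symmetric] del: fpow_less_iff)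

text \<open>Without such a \<open>k\<close>, the inequality \<open>fpow k x \<le> y\<close> would
  pass from some negative \<open>k\<close> to all larger ones, although the orbit of
  \<open>x\<close> is unbounded above.\<close>

lemma level_exists: "\<exists>k. fpow k x \<le> y \<and> y < fpow (k + 1) x"
proof (rule ccontr)
  assume "\<not> ?thesis"
  then have step: "fpow (k + 1) x \<le> y" if "fpow k x \<le> y" for k
    using that by (auto simp: not_less)
  obtain m where "(finv f ^^ m) x < y"
    using funpow_eventually_below[OF inv_mem[OF f_mem], of y x] f_gt
    by (auto simp: inv_less_iff[OF f_mem])
  then have m: "fpow (- int m) x \<le> y" by (cases "m = 0") (auto simp: fpow_def)
  obtain n where "y < (f ^^ n) x"
    using funpow_eventually_above[OF f_mem, of x y] f_gt by auto
  then have n: "y < fpow (int n) x" by simp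
  have "fpow (- int m + int j) x \<le> y" for j
  proof (induction j)
    case (Suc j)
    then show ?case using step[of "- int m + int j"] by (simp add: add_ac)
  qed (use m in simp)
  from this[of "m + n"] n show False by simp
qed

text \<open>Holding in both directions means, by the intermediate value theorem, that the graphs of
  \<open>g\<close> and \<open>h\<close> meet, that is, \<open>finv g \<circ> h\<close> has a fixed
  point. The relation thus ranks elements modulo those with a fixed point.\<close>

definition weakly_le :: "(real \<Rightarrow> real) \<Rightarrow> (real \<Rightarrow> real) \<Rightarrow> bool" (infix "\<preceq>" 50) where
  "g \<preceq> h \<longleftrightarrow> (\<exists>x. g x \<le> h x)"

lemma weakly_le_refl: "g \<preceq> g"
  by (auto simp: weakly_le_def)

lemma weakly_le_linear: "g \<preceq> h \<or> h \<preceq> g"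
  unfolding weakly_le_def by (meson linear)

text \<open>Each of \<open>finv g \<circ> h\<close> and \<open>finv h \<circ> k\<close> fails to
  lower some point, hence so does their product \<open>finv g \<circ> k\<close> by
  \<open>nonneg_comp\<close>.\<close>

lemma weakly_le_trans:
  assumes G: "g \<in> G" "h \<in> G" "k \<in> G" and "g \<preceq> h" "h \<preceq> k"
  shows "g \<preceq> k"
proof -
  obtain x y where "g x \<le> h x" "h y \<le> k y"
    using assms by (auto simp: weakly_le_def)
  then have "x \<le> (finv g \<circ> h) x" "y \<le> (finv h \<circ> k) y"
    by (auto simp: le_inv_iff[OF G(1)] le_inv_iff[OF G(2)])
  then obtain z where "z \<le> (finv g \<circ> h) ((finv h \<circ> k) z)"
    using nonneg_comp[of "finv g \<circ> h" "finv h \<circ> k"] G comp_mem inv_mem by blast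
  then have "g z \<le> k z"
    by (simp add: le_inv_iff[OF G(1)] app_inv[OF G(2)])
  then show ?thesis by (auto simp: weakly_le_def)
qed

lemma weakly_le_comp:
  assumes G: "g \<in> G" "g' \<in> G" "h \<in> G" "h' \<in> G" and "g \<preceq> g'" "h \<preceq> h'"
  shows "g \<circ> h \<preceq> g' \<circ> h'"
proof (rule weakly_le_trans)
  obtain x y where "g x \<le> g' x" "h y \<le> h' y"
    using assms by (auto simp: weakly_le_def)
  then show "g \<circ> h \<preceq> g' \<circ> h" "g' \<circ> h \<preceq> g' \<circ> h'"
    unfolding weakly_le_def
    by (auto simp: app_inv[OF G(3)] le_iff[OF G(2)] intro: exI[of _ "finv h x"])
qed (auto intro: comp_mem G)

lemma weakly_le_funpow:
  assumes "g \<in> G" "h \<in> G" "g \<preceq> h"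
  shows "g ^^ n \<preceq> h ^^ n"
proof (induction n)
  case (Suc n)
  then show ?case unfolding funpow.simps by (intro weakly_le_comp funpow_mem assms)
qed (simp add: weakly_le_refl)

lemma weakly_le_fpow_iff: "fpow i \<preceq> fpow j \<longleftrightarrow> i \<le> j"
  by (simp add: weakly_le_def)

text \<open>The integer part of \<open>g\<close> in units of \<open>f\<close>, read off at the base
  point 0; \<open>level_eqI\<close> shows that the choice is unique.\<close>

definition level :: "(real \<Rightarrow> real) \<Rightarrow> int" where
  "level g = (SOME k. fpow k 0 \<le> g 0 \<and> g 0 < fpow (k + 1) 0)"

lemma level: "fpow (level g) 0 \<le> g 0" "g 0 < fpow (level g + 1) 0"
  using someI_ex[OF level_exists[of 0 "g 0"]] by (auto simp: level_def)

lemma level_eqI: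
  assumes "fpow k 0 \<le> g 0" "g 0 < fpow (k + 1) 0"
  shows "level g = k"
proof -
  have "fpow k 0 < fpow (level g + 1) 0" "fpow (level g) 0 < fpow (k + 1) 0"
    using assms level[of g] by linarith+
  then show ?thesis by simp
qed

lemma fpow_level_le: "fpow (level g) \<preceq> g" "g \<preceq> fpow (level g + 1)"
  using level[of g] by (auto simp: weakly_le_def intro: less_imp_le)

text \<open>The loss of 1 occurs because \<open>\<preceq>\<close> may hold at a point other than 0,
  so \<open>h\<close> is rounded up to a power of \<open>f\<close>.\<close>

lemma level_mono:
  assumes "g \<in> G" "h \<in> G" "g \<preceq> h"
  shows "level g \<le> level h + 1"
proof -
  have "fpow (level g) \<preceq> fpow (level h + 1)"
    using assms fpow_level_le weakly_le_trans fpow_mem by meson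
  then show ?thesis by (simp add: weakly_le_fpow_iff)
qed

text \<open>Rounding both factors down or up to powers of \<open>f\<close> encloses the product;
  thus \<open>level\<close> is a quasimorphism.\<close>

lemma level_comp:
  assumes G: "g \<in> G" "h \<in> G"
  shows "\<bar>level (g \<circ> h) - (level g + level h)\<bar> \<le> 2"
proof -
  have add: "fpow i \<circ> fpow j = fpow (i + j)" for i j by (simp add: fun_eq_iff fpow_add)
  have "fpow (level g) \<circ> fpow (level h) \<preceq> g \<circ> h"
    by (intro weakly_le_comp fpow_mem G fpow_level_le)
  then have "fpow (level g + level h) \<preceq> fpow (level (g \<circ> h) + 1)"
    using fpow_level_le(2)[of "g \<circ> h"] weakly_le_trans fpow_mem comp_mem G unfolding add by meson
  moreover have "g \<circ> h \<preceq> fpow (level g + 1) \<circ> fpow (level h + 1)"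
    by (intro weakly_le_comp fpow_mem G fpow_level_le)
  then have "fpow (level (g \<circ> h)) \<preceq> fpow (level g + 1 + (level h + 1))"
    using fpow_level_le(1)[of "g \<circ> h"] weakly_le_trans fpow_mem comp_mem G unfolding add by meson
  ultimately show ?thesis by (simp add: weakly_le_fpow_iff)
qed

lemma level_funpow_base [simp]: "level (f ^^ n) = int n"
  using fpow_less_iff[of "int n" 0 "int n + 1"] by (intro level_eqI) auto

lemma level_funpow:
  assumes "g \<in> G"
  shows "\<bar>level (g ^^ m) - int m * level g\<bar> \<le> 2 * int m"
proof (induction m)
  case (Suc m)
  have "\<bar>level (g ^^ Suc m) - (level g + level (g ^^ m))\<bar> \<le> 2"
    unfolding funpow.simps by (intro level_comp assms funpow_mem)
  with Suc show ?case by (simp add: algebra_simps del: funpow.simps)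
next
  case 0
  have "level (g ^^ 0) = 0" using level_funpow_base[of 0] by (simp only: funpow.simps of_nat_0)
  then show ?case by linarith
qed

text \<open>Both quotients are compared with the one at exponent \<open>m * n\<close>; the Cauchy
  property follows.\<close>

lemma level_funpow_ratio:
  assumes "g \<in> G" "0 < m" "0 < n"
  shows "\<bar>level (g ^^ m) / m - level (g ^^ n) / n\<bar> \<le> 2 / m + 2 / n"
proof -
  have *: "\<bar>level (g ^^ (k * l)) / real (k * l) - level (g ^^ k) / k\<bar> \<le> 2 / k"
    if "0 < k" "0 < l" for k l
  proof -
    have "\<bar>level ((g ^^ k) ^^ l) - int l * level (g ^^ k)\<bar> \<le> 2 * int l"
      using assms by (intro level_funpow funpow_mem)
    then have "\<bar>level (g ^^ (k * l)) - int l * level (g ^^ k)\<bar> \<le> 2 * int l"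
      by (simp add: funpow_mult mult.commute)
    then have "real_of_int \<bar>level (g ^^ (k * l)) - int l * level (g ^^ k)\<bar> \<le> real_of_int (2 * int l)"
      by (simp only: of_int_le_iff)
    then have "\<bar>real_of_int (level (g ^^ (k * l))) - l * level (g ^^ k)\<bar> \<le> 2 * l"
      by simp
    then have "\<bar>real_of_int (level (g ^^ (k * l))) - l * level (g ^^ k)\<bar> / (k * l) \<le> 2 * l / (k * l)"
      by (rule divide_right_mono) simp
    moreover have "\<bar>real_of_int (level (g ^^ (k * l))) - l * level (g ^^ k)\<bar> / (k * l)
        = \<bar>(real_of_int (level (g ^^ (k * l))) - l * level (g ^^ k)) / (k * l)\<bar>"
      by (simp add: abs_divide)
    moreover have "(real_of_int (level (g ^^ (k * l))) - l * level (g ^^ k)) / (k * l)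
        = level (g ^^ (k * l)) / real (k * l) - level (g ^^ k) / k"
      using that by (simp add: diff_divide_distrib)
    ultimately have "\<bar>level (g ^^ (k * l)) / real (k * l) - level (g ^^ k) / k\<bar> \<le> 2 * l / (k * l)"
      by (simp only:)
    then show ?thesis using that by simp
  qed
  show ?thesis using *[of m n] *[of n m] assms by (simp add: mult.commute)
qed

text \<open>The homogenization of the quasimorphism \<open>level\<close>, which is the homomorphism
  to the reals in Hoelder's argument.\<close>

definition trans_num :: "(real \<Rightarrow> real) \<Rightarrow> real" where
  "trans_num g = lim (\<lambda>n. level (g ^^ n) / n)"

lemma trans_num_LIMSEQ:
  assumes "g \<in> G"
  shows "(\<lambda>n. level (g ^^ n) / n) \<longlonglongrightarrow> trans_num g"
proof -
  have "Cauchy (\<lambda>n. level (g ^^ n) / n)"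
  proof (rule CauchyI)
    fix e :: real assume "0 < e"
    obtain N where N: "4 / e < real N" using reals_Archimedean2 by blast
    have "0 < real N" using N \<open>0 < e\<close> by (meson divide_pos_pos less_trans zero_less_numeral)
    have "norm (level (g ^^ m) / m - level (g ^^ n) / n) < e" if "N \<le> m" "N \<le> n" for m n
    proof -
      have "norm (level (g ^^ m) / m - level (g ^^ n) / n) \<le> 2 / m + 2 / n"
        using level_funpow_ratio[OF assms, of m n] that \<open>0 < real N\<close> by simp
      also have "\<dots> \<le> 2 / N + 2 / N"
        using that \<open>0 < real N\<close> by (intro add_mono divide_left_mono) auto
      also have "\<dots> < e" using N \<open>0 < e\<close> \<open>0 < real N\<close> by (simp add: field_simps)
      finally show ?thesis .
    qed
    then show "\<exists>M. \<forall>m\<ge>M. \<forall>n\<ge>M. norm (level (g ^^ m) / m - level (g ^^ n) / n) < e" by blast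
  qed
  then show ?thesis
    unfolding trans_num_def by (simp add: Cauchy_convergent_iff convergent_LIMSEQ_iff)
qed

lemma trans_num_mono:
  assumes "g \<in> G" "h \<in> G" "g \<preceq> h"
  shows "trans_num g \<le> trans_num h"
proof (rule LIMSEQ_le)
  show "(\<lambda>n. level (g ^^ n) / n) \<longlonglongrightarrow> trans_num g" by (intro trans_num_LIMSEQ assms)
  have "(\<lambda>n. level (h ^^ n) / n + 1 / n) \<longlonglongrightarrow> trans_num h + 0"
    by (intro tendsto_add trans_num_LIMSEQ assms lim_1_over_n)
  then show "(\<lambda>n. level (h ^^ n) / n + 1 / n) \<longlonglongrightarrow> trans_num h" by simp
  have "level (g ^^ n) / n \<le> level (h ^^ n) / n + 1 / n" for n
  proof -
    have "level (g ^^ n) \<le> level (h ^^ n) + 1"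
      by (intro level_mono funpow_mem weakly_le_funpow assms)
    then have "real_of_int (level (g ^^ n)) / n \<le> (level (h ^^ n) + 1) / n"
      by (intro divide_right_mono) linarith+
    then show ?thesis by (simp add: add_divide_distrib)
  qed
  then show "\<exists>N. \<forall>n\<ge>N. level (g ^^ n) / n \<le> level (h ^^ n) / n + 1 / n" by blast
qed

text \<open>Stated for an abstract order since it is applied to \<open>\<preceq>\<close> and to its converse.\<close>

lemma funpow_comp_sorted:
  assumes trans: "\<And>g h k. g \<in> G \<Longrightarrow> h \<in> G \<Longrightarrow> k \<in> G \<Longrightarrow> R g h \<Longrightarrow> R h k \<Longrightarrow> R g k"
    and comp: "\<And>g g' h h'. g \<in> G \<Longrightarrow> g' \<in> G \<Longrightarrow> h \<in> G \<Longrightarrow> h' \<in> G \<Longrightarrow> R g g' \<Longrightarrow> R h h' \<Longrightarrow> R (g \<circ> h) (g' \<circ> h')"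
    and refl: "\<And>g. R g g"
    and G: "g \<in> G" "h \<in> G" and gh: "R (g \<circ> h) (h \<circ> g)"
  shows "R (g ^^ n \<circ> h ^^ n) ((g \<circ> h) ^^ n)"
proof -
  have mem: "g ^^ n \<in> G" "h ^^ n \<in> G" "(g \<circ> h) ^^ n \<in> G" for n
    by (auto intro: funpow_mem comp_mem G)
  \<comment> \<open>Each exchange that moves a \<open>g\<close> to the right past an
    \<open>h\<close> goes up in \<open>R\<close>; sorting a word proceeds by moving one
    \<open>g\<close> past a block of \<open>h\<close>.\<close>
  have swap: "R (g \<circ> h ^^ n) (h ^^ n \<circ> g)" for n
  proof (induction n)
    case (Suc n)
    have "R (g \<circ> h \<circ> h ^^ n) (h \<circ> g \<circ> h ^^ n)"
      by (intro comp refl gh comp_mem mem G)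
    moreover have "R (h \<circ> (g \<circ> h ^^ n)) (h \<circ> (h ^^ n \<circ> g))"
      by (intro comp refl Suc.IH comp_mem mem G)
    ultimately show ?case
      unfolding funpow.simps comp_assoc[symmetric]
      by (intro trans[of "g \<circ> h \<circ> h ^^ n" "h \<circ> g \<circ> h ^^ n" "h \<circ> h ^^ n \<circ> g"] comp_mem mem G)
        (simp_all only: comp_assoc)
  qed (simp add: refl)
  show ?thesis
  proof (induction n)
    case (Suc n)
    have eq1: "g ^^ Suc n \<circ> h ^^ Suc n = g ^^ n \<circ> (g \<circ> h ^^ n) \<circ> h"
      by (simp add: funpow_Suc_right comp_assoc del: funpow.simps(2))
    have eq2: "(g \<circ> h) ^^ Suc n = (g \<circ> h) ^^ n \<circ> g \<circ> h"
      by (simp only: funpow_Suc_right comp_assoc)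
    have "R (g ^^ n \<circ> (g \<circ> h ^^ n) \<circ> h) (g ^^ n \<circ> (h ^^ n \<circ> g) \<circ> h)"
      by (intro comp refl swap comp_mem mem G)
    moreover have "R (g ^^ n \<circ> h ^^ n \<circ> g \<circ> h) ((g \<circ> h) ^^ n \<circ> g \<circ> h)"
      by (intro comp refl Suc.IH comp_mem mem G)
    ultimately show ?case
      unfolding eq1 eq2
      by (intro trans[of "g ^^ n \<circ> (g \<circ> h ^^ n) \<circ> h" "g ^^ n \<circ> h ^^ n \<circ> g \<circ> h" "(g \<circ> h) ^^ n \<circ> g \<circ> h"]
          comp_mem mem G) (simp_all add: comp_assoc)
  qed (simp add: refl)
qed

text \<open>The weak order encloses \<open>(g \<circ> h) ^^ n\<close> between the two products of
  \<open>g ^^ n\<close> and \<open>h ^^ n\<close>, both of level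
  \<open>level (g ^^ n) + level (h ^^ n)\<close> up to 2. The error stays bounded and vanishes after
  division by \<open>n\<close>.\<close>

lemma trans_num_comp:
  assumes G: "g \<in> G" "h \<in> G"
  shows "trans_num (g \<circ> h) = trans_num g + trans_num h"
proof -
  have bound: "\<bar>level ((g \<circ> h) ^^ n) - (level (g ^^ n) + level (h ^^ n))\<bar> \<le> 4" for n
  proof -
    have mem: "g ^^ n \<in> G" "h ^^ n \<in> G" "(g \<circ> h) ^^ n \<in> G" "(h \<circ> g) ^^ n \<in> G"
      by (auto intro: funpow_mem comp_mem G)
    \<comment> \<open>Which product is the lower bound depends on how \<open>g \<circ> h\<close>
      compares with \<open>h \<circ> g\<close>; \<open>p\<close> names the lower and
      \<open>q\<close> the upper one.\<close>
    have sand: "\<exists>p q. {p, q} = {g ^^ n \<circ> h ^^ n, h ^^ n \<circ> g ^^ n} \<and> p \<preceq> (g \<circ> h) ^^ n \<and> (g \<circ> h) ^^ n \<preceq> q"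
    proof (cases "g \<circ> h \<preceq> h \<circ> g")
      case True
      have "g ^^ n \<circ> h ^^ n \<preceq> (g \<circ> h) ^^ n"
        by (rule funpow_comp_sorted[where R = "(\<preceq>)"])
          (use True G in \<open>auto intro: weakly_le_trans weakly_le_comp weakly_le_refl\<close>)
      moreover have "(h \<circ> g) ^^ n \<preceq> h ^^ n \<circ> g ^^ n"
        by (rule funpow_comp_sorted[where R = "\<lambda>g h. h \<preceq> g"])
          (use True G in \<open>auto intro: weakly_le_trans weakly_le_comp weakly_le_refl\<close>)
      moreover have "(g \<circ> h) ^^ n \<preceq> (h \<circ> g) ^^ n"
        using True G by (intro weakly_le_funpow comp_mem)
      ultimately have "g ^^ n \<circ> h ^^ n \<preceq> (g \<circ> h) ^^ n" "(g \<circ> h) ^^ n \<preceq> h ^^ n \<circ> g ^^ n"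
        using weakly_le_trans[OF mem(3) mem(4) comp_mem[OF mem(2,1)]] by auto
      then show ?thesis by blast
    next
      case False
      then have hg: "h \<circ> g \<preceq> g \<circ> h" using weakly_le_linear by blast
      have "(g \<circ> h) ^^ n \<preceq> g ^^ n \<circ> h ^^ n"
        by (rule funpow_comp_sorted[where R = "\<lambda>g h. h \<preceq> g"])
          (use hg G in \<open>auto intro: weakly_le_trans weakly_le_comp weakly_le_refl\<close>)
      moreover have "h ^^ n \<circ> g ^^ n \<preceq> (h \<circ> g) ^^ n"
        by (rule funpow_comp_sorted[where R = "(\<preceq>)"])
          (use hg G in \<open>auto intro: weakly_le_trans weakly_le_comp weakly_le_refl\<close>)
      moreover have "(h \<circ> g) ^^ n \<preceq> (g \<circ> h) ^^ n"
        using hg G by (intro weakly_le_funpow comp_mem)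
      ultimately have "h ^^ n \<circ> g ^^ n \<preceq> (g \<circ> h) ^^ n" "(g \<circ> h) ^^ n \<preceq> g ^^ n \<circ> h ^^ n"
        using weakly_le_trans[OF comp_mem[OF mem(2,1)] mem(4) mem(3)] by auto
      then show ?thesis by blast
    qed
    then obtain p q where pq: "{p, q} = {g ^^ n \<circ> h ^^ n, h ^^ n \<circ> g ^^ n}"
      and le: "p \<preceq> (g \<circ> h) ^^ n" "(g \<circ> h) ^^ n \<preceq> q" by blast
    have "p \<in> {g ^^ n \<circ> h ^^ n, h ^^ n \<circ> g ^^ n}" "q \<in> {g ^^ n \<circ> h ^^ n, h ^^ n \<circ> g ^^ n}"
      using pq by blast+
    then have "\<bar>level p - (level (g ^^ n) + level (h ^^ n))\<bar> \<le> 2"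
      "\<bar>level q - (level (g ^^ n) + level (h ^^ n))\<bar> \<le> 2" "p \<in> G" "q \<in> G"
      using level_comp[OF mem(1,2)] level_comp[OF mem(2,1)] mem comp_mem by auto
    then show ?thesis using level_mono[OF _ mem(3) le(1)] level_mono[OF mem(3) _ le(2)] by linarith
  qed
  have "(\<lambda>n. level ((g \<circ> h) ^^ n) / n - (level (g ^^ n) / n + level (h ^^ n) / n))
      \<longlonglongrightarrow> trans_num (g \<circ> h) - (trans_num g + trans_num h)"
    by (intro tendsto_diff tendsto_add trans_num_LIMSEQ comp_mem G)
  moreover have "(\<lambda>n. level ((g \<circ> h) ^^ n) / n - (level (g ^^ n) / n + level (h ^^ n) / n)) \<longlonglongrightarrow> 0"
  proof (rule tendsto_rabs_zero_cancel, rule tendsto_sandwich[OF _ _ tendsto_const])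
    show "(\<lambda>n. 4 * (1 / real n)) \<longlonglongrightarrow> 0"
      using tendsto_mult_right_zero[OF lim_1_over_n] by simp
    have "\<bar>level ((g \<circ> h) ^^ n) / n - (level (g ^^ n) / n + level (h ^^ n) / n)\<bar> \<le> 4 * (1 / real n)" for n
    proof -
      have "\<bar>real_of_int (level ((g \<circ> h) ^^ n)) - (level (g ^^ n) + level (h ^^ n))\<bar> \<le> 4"
        using bound[of n] by linarith
      then have "\<bar>real_of_int (level ((g \<circ> h) ^^ n)) - (level (g ^^ n) + level (h ^^ n))\<bar> / n \<le> 4 / n"
        by (rule divide_right_mono) simp
      then show ?thesis
        by (simp add: abs_divide flip: diff_divide_distrib add_divide_distrib)
    qed
    then show "\<forall>\<^sub>F n in sequentially. \<bar>level ((g \<circ> h) ^^ n) / n - (level (g ^^ n) / n + level (h ^^ n) / n)\<bar> \<le> 4 * (1 / real n)"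
      by simp
  qed simp
  ultimately have "trans_num (g \<circ> h) - (trans_num g + trans_num h) = 0" by (rule LIMSEQ_unique)
  then show ?thesis by simp
qed

lemma trans_num_inv: "g \<in> G \<Longrightarrow> trans_num (finv g) = - trans_num g"
proof -
  assume g: "g \<in> G"
  have "trans_num id = 0" using trans_num_comp[OF id_mem id_mem] by simp
  moreover have "finv g \<circ> g = id" using g by (simp add: fun_eq_iff inv_app)
  ultimately show ?thesis using trans_num_comp[OF inv_mem[OF g] g] by simp
qed

lemma trans_num_f: "trans_num f = 1"
proof -
  have "(\<lambda>n. level (f ^^ n) / n) \<longlonglongrightarrow> 1"
    by (rule tendsto_eventually) (auto intro!: eventually_sequentiallyI[of 1])
  then show ?thesis using trans_num_LIMSEQ[OF f_mem] LIMSEQ_unique by blast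
qed

text \<open>Strictness of \<open>x < g 0\<close> makes the infimum continuous from the right, as a
  distribution function has to be.\<close>

definition height :: "real \<Rightarrow> real" where
  "height x = Inf (trans_num ` {g \<in> G. x < g 0})"

lemma height_set:
  shows "trans_num ` {g \<in> G. x < g 0} \<noteq> {}" "bdd_below (trans_num ` {g \<in> G. x < g 0})"
proof -
  obtain k where k: "fpow k 0 \<le> x" "x < fpow (k + 1) 0" using level_exists by blast
  then show "trans_num ` {g \<in> G. x < g 0} \<noteq> {}" using fpow_mem by auto
  show "bdd_below (trans_num ` {g \<in> G. x < g 0})"
  proof (rule bdd_belowI2)
    fix g assume "g \<in> {g \<in> G. x < g 0}"
    then have "g \<in> G" "fpow k \<preceq> g" using k by (auto simp: weakly_le_def intro!: exI[of _ 0])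
    then show "trans_num (fpow k) \<le> trans_num g" by (intro trans_num_mono fpow_mem)
  qed
qed

lemma height_le: "g \<in> G \<Longrightarrow> x < g 0 \<Longrightarrow> height x \<le> trans_num g"
  unfolding height_def by (intro cInf_lower height_set) auto

lemma height_greatest: "(\<And>g. g \<in> G \<Longrightarrow> x < g 0 \<Longrightarrow> c \<le> trans_num g) \<Longrightarrow> c \<le> height x"
  unfolding height_def by (intro cInf_greatest height_set) auto

lemma height_mono: "x \<le> y \<Longrightarrow> height x \<le> height y"
  by (intro height_greatest height_le) auto

text \<open>Composition with \<open>h\<close> turns elements that send 0 beyond \<open>x\<close>
  into such elements for \<open>h x\<close> and adds \<open>trans_num h\<close> to their value. This
  gives one inequality; applied to \<open>finv h\<close> it gives the other.\<close>

lemma height_equivariant: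
  assumes h: "h \<in> G"
  shows "height (h x) = height x + trans_num h"
proof -
  have *: "height (h x) - trans_num h \<le> height x" if h: "h \<in> G" for h x
  proof (rule height_greatest)
    fix g assume g: "g \<in> G" "x < g 0"
    then have "height (h x) \<le> trans_num (h \<circ> g)"
      using h by (intro height_le comp_mem) (auto simp: less_iff[OF h])
    then show "height (h x) - trans_num h \<le> trans_num g"
      using trans_num_comp[OF h g(1)] by simp
  qed
  show ?thesis
    using *[OF h, of x] *[OF inv_mem[OF h], of "h x"]
    by (simp add: inv_app[OF h] trans_num_inv[OF h])
qed

lemma height_continuous_right: "continuous (at_right a) height"
  unfolding continuous_within
proof (rule order_tendstoI)
  fix c assume "c < height a"
  then show "\<forall>\<^sub>F x in at_right a. c < height x"
    unfolding eventually_at_right_field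
    by (intro exI[of _ "a + 1"]) (auto intro: less_le_trans[OF _ height_mono])
next
  fix c assume "height a < c"
  then obtain t where "t \<in> trans_num ` {g \<in> G. a < g 0}" "t < c"
    unfolding height_def using height_set by (meson cInf_lessD)
  then obtain g where g: "g \<in> G" "a < g 0" "trans_num g < c" by auto
  then show "\<forall>\<^sub>F x in at_right a. height x < c"
    unfolding eventually_at_right_field
    by (intro exI[of _ "g 0"]) (auto intro: le_less_trans[OF height_le])
qed

lemma invariant_Radon_measure:
  "\<exists>\<mu>. Radon_measure \<mu> \<and> emeasure \<mu> UNIV \<noteq> 0 \<and> invariant_measure G \<mu>"
proof (rule invariant_measureI[where F = height])
  show "height 0 < height (f 0)" using height_equivariant[OF f_mem, of 0] by (simp add: trans_num_f)
qed (auto intro: height_mono height_continuous_right height_equivariant)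

lemma minimal_set: "\<exists>K. minimal_closed_invariant G K"
proof (rule minimal_closed_invariant_if_compact_meets)
  show "compact {0..f 0}" by simp
  fix x
  obtain k where k: "fpow k 0 \<le> x" "x < fpow (k + 1) 0" using level_exists by blast
  have cancel: "fpow (- k) (fpow k y) = y" for y using fpow_add[of "- k" k y] by simp
  have "fpow (- k) (fpow k 0) \<le> fpow (- k) x" "fpow (- k) x < fpow (- k) (fpow (k + 1) 0)"
    using k by (auto simp: le_iff[OF fpow_mem] less_iff[OF fpow_mem])
  moreover have "fpow (- k) (fpow (k + 1) 0) = f 0"
    using fpow_add[of "- k" "k + 1" 0] fpow_of_nat[of 1] by simp
  ultimately have "fpow (- k) x \<in> {0..f 0}" by (simp add: cancel)
  then show "\<exists>g\<in>G. g x \<in> {0..f 0}" using fpow_mem by blast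
qed

end

section \<open>Actions with an element free of fixed points\<close>

context no_ping_pong
begin

text \<open>By the intermediate value theorem a map without fixed points moves all points in one
  direction; the inverse is taken if this is to the left.\<close>

lemma conclusion_if_free_element:
  assumes g: "g \<in> G" and free: "\<And>x. g x \<noteq> x"
  shows "\<exists>\<mu>. Radon_measure \<mu> \<and> emeasure \<mu> UNIV \<noteq> 0 \<and> invariant_measure G \<mu>"
    and "\<exists>K. minimal_closed_invariant G K"
proof -
  have "\<exists>f\<in>G. \<forall>x. x < f x"
  proof (cases "0 < g 0")
    case True
    have "x < g x" for x
    proof (rule ccontr)
      assume "\<not> x < g x"
      then have x: "g x < x" using free[of x] by simp
      consider "0 \<le> x" | "x < 0" by linarith
      then show False
      proof cases
        case 1
        then show False using fixed_between[OF g, of 0 x] True x free by force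
      next
        case 2
        have "\<exists>z. x \<le> z \<and> z \<le> 0 \<and> finv g z = z"
          using 2 x True by (intro fixed_between inv_mem g) (auto simp: le_inv_iff[OF g] inv_le_iff[OF g])
        then show False using free by (auto simp: inv_eq_iff[OF g]) (metis free)
      qed
    qed
    then show ?thesis using g by blast
  next
    case False
    then have 0: "g 0 < 0" using free[of 0] by simp
    have "x < finv g x" for x
    proof (rule ccontr)
      assume "\<not> x < finv g x"
      then have x: "x < g x" using free[of x] by (simp add: less_inv_iff[OF g])
      consider "x \<le> 0" | "0 < x" by linarith
      then show False
      proof cases
        case 1
        then show False using fixed_between[OF g, of x 0] 0 x free by force
      next
        case 2
        have "\<exists>z. 0 \<le> z \<and> z \<le> x \<and> finv g z = z"
          using 2 x 0 by (intro fixed_between inv_mem g) (auto simp: le_inv_iff[OF g] inv_le_iff[OF g])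
        then show False using free by (auto simp: inv_eq_iff[OF g]) (metis free)
      qed
    qed
    then show ?thesis using inv_mem[OF g] by blast
  qed
  then obtain f where f: "f \<in> G" "\<And>x. x < f x" by blast
  interpret free_element G f by unfold_locales (use f in auto)
  show "\<exists>\<mu>. Radon_measure \<mu> \<and> emeasure \<mu> UNIV \<noteq> 0 \<and> invariant_measure G \<mu>"
    by (rule invariant_Radon_measure)
  show "\<exists>K. minimal_closed_invariant G K" by (rule minimal_set)
qed

end

section \<open>Paths of small total length\<close>

text \<open>For \<open>t\<close> in the fibre, \<open>n * t\<close> lies in a window of length
  \<open>Q\<close>, so the fibre has at most \<open>Q / n + 1\<close> elements, and
  \<open>n \<le> Q\<close> absorbs the 1.\<close>

lemma card_div_fiber:
  fixes n Q a :: nat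
  assumes "1 \<le> n" "n \<le> Q"
  shows "real (card {t \<in> {..<Q}. n * t div Q = a}) \<le> 2 * real Q / real n"
proof -
  let ?A = "{t \<in> {..<Q}. n * t div Q = a}"
  show ?thesis
  proof (cases "?A = {}")
    case False
    define m where "m = Min ?A"
    have fin: "finite ?A" by simp
    have m: "m \<in> ?A" unfolding m_def using False fin by (rule Min_in[rotated])
    have "?A \<subseteq> {m..m + Q div n}"
    proof
      fix t assume t: "t \<in> ?A"
      then have "m \<le> t" unfolding m_def using fin by (intro Min_le) auto
      have "n * t < Q + Q * (n * t div Q)" using assms by (intro dividend_less_times_div) auto
      moreover have a: "n * m div Q = a" using m by simp
      have "Q * a \<le> n * m" using times_div_less_eq_dividend[of Q "n * m"] unfolding a .
      ultimately have "n * t < n * m + Q" using t m by simp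
      then have "n * (t - m) \<le> Q" by (simp add: diff_mult_distrib2)
      then have "t - m \<le> Q div n" using assms
        by (simp add: less_eq_div_iff_mult_less_eq mult.commute)
      then show "t \<in> {m..m + Q div n}" using \<open>m \<le> t\<close> by auto
    qed
    then have "card ?A \<le> card {m..m + Q div n}" by (intro card_mono) auto
    then have "real (card ?A) \<le> real (Q div n) + 1" by simp
    also have "real (Q div n) \<le> real Q / real n" by (rule of_nat_div_le_of_nat)
    also have "real Q / real n + 1 \<le> 2 * real Q / real n" using assms by (simp add: field_simps)
    finally show ?thesis by simp
  next
    case True
    then show ?thesis by (simp only:) simp
  qed
qed

text \<open>Telescoping of \<open>1 / N - 1 / (N + 1)\<close>. At \<open>N = 0\<close> the bound
  reads 2, as division by zero gives 0.\<close>

lemma sum_inverse_squares_le: "(\<Sum>n=1..N. 1 / real n ^ 2) \<le> 2 - 1 / real N"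
proof (induction N)
  case (Suc N)
  have "1 / real (Suc N) ^ 2 \<le> 1 / real N - 1 / real (Suc N)" if "N > 0"
  proof -
    have "1 / real (Suc N) ^ 2 \<le> 1 / (real N * real (Suc N))"
      using that by (intro divide_left_mono) (auto simp: power2_eq_square)
    also have "\<dots> = 1 / real N - 1 / real (Suc N)" using that by (simp add: field_simps)
    finally show ?thesis .
  qed
  with Suc show ?case by (cases "N = 0") auto
qed simp

lemma sum_fiber_bound:
  fixes len :: "'b \<Rightarrow> real"
  assumes "finite T" and fib: "\<And>v. v \<in> X ` T \<Longrightarrow> real (card {t \<in> T. X t = v}) \<le> K"
    and len: "\<And>v. 0 \<le> len v" and M: "sum len (X ` T) \<le> M"
    and K: "0 \<le> K"
  shows "(\<Sum>t\<in>T. len (X t)) \<le> K * M"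
proof -
  have "(\<Sum>t\<in>T. len (X t)) = (\<Sum>v\<in>X ` T. \<Sum>t\<in>{t \<in> T. X t = v}. len (X t))"
    using assms(1) by (rule sum.image_gen)
  also have "\<dots> = (\<Sum>v\<in>X ` T. real (card {t \<in> T. X t = v}) * len v)"
    by (intro sum.cong) auto
  also have "\<dots> \<le> (\<Sum>v\<in>X ` T. K * len v)"
    using fib len by (intro sum_mono mult_right_mono) auto
  also have "\<dots> \<le> K * M"
    using M K by (simp add: sum_distrib_left[symmetric] mult_left_mono)
  finally show ?thesis .
qed

text \<open>Up to the threshold \<open>c\<close> monotonicity of the power suffices; beyond it
  \<open>l powr (\<beta> - 1)\<close> is at most \<open>c powr (\<beta> - 1)\<close>. The linear
  bound turns control of total length into control of powers of lengths.\<close>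

lemma powr_le_threshold:
  fixes \<beta> l c :: real
  assumes "0 < \<beta>" "\<beta> \<le> 1" "0 \<le> l" "0 < c"
  shows "l powr \<beta> \<le> c powr \<beta> + c powr (\<beta> - 1) * l"
proof (cases "l \<le> c")
  case True
  then have "l powr \<beta> \<le> c powr \<beta>" using assms by (intro powr_mono2) auto
  then show ?thesis using assms by (simp add: add_increasing2)
next
  case False
  have "l powr \<beta> = l powr (\<beta> - 1) * l"
    using False assms by (simp add: powr_diff)
  also have "\<dots> \<le> c powr (\<beta> - 1) * l"
    using False assms by (intro mult_right_mono powr_mono2') auto
  finally show ?thesis by (simp add: add_increasing)
qed

text \<open>The line segment from 0 to \<open>t\<close>, walked in \<open>Q\<close> steps and
  rounded down; a coordinate with \<open>t i < Q\<close> advances by 0 or 1 per step. The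
  restriction makes equality of points depend on the first \<open>d\<close> coordinates
  only.\<close>

definition grid_path :: "nat \<Rightarrow> nat \<Rightarrow> (nat \<Rightarrow> nat) \<Rightarrow> nat \<Rightarrow> nat \<Rightarrow> nat" where
  "grid_path d Q t n = (\<lambda>i\<in>{..<d}. n * t i div Q)"

text \<open>Average over \<open>t\<close>: a given vector is the \<open>n\<close>-th point of at most \<open>(2 Q / n)\<^sup>d\<close> of the
  \<open>Q\<^sup>d\<close> paths, so the mean of \<open>len powr \<beta>\<close> at time \<open>n\<close> is of order \<open>n powr (- d \<beta>)\<close>.\<close>

lemma grid_path_sum_bounded:
  fixes len :: "(nat \<Rightarrow> nat) \<Rightarrow> real"
  assumes \<beta>: "0 < \<beta>" "\<beta> \<le> 1" and d: "2 \<le> real d * \<beta>" and Q: "1 \<le> Q"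
    and len: "\<And>v. 0 \<le> len v" and M: "\<And>V. finite V \<Longrightarrow> V \<subseteq> (\<Pi>\<^sub>E i\<in>{..<d}. UNIV) \<Longrightarrow> sum len V \<le> M"
  shows "\<exists>t \<in> (\<Pi>\<^sub>E i\<in>{..<d}. {..<Q}). (\<Sum>n=1..Q. len (grid_path d Q t n) powr \<beta>) \<le> 2 * (1 + 2 ^ d * M)"
proof (rule ccontr)
  let ?T = "\<Pi>\<^sub>E i\<in>{..<d}. {..<Q}" and ?X = "\<lambda>n t. grid_path d Q t n"
  let ?B = "2 * (1 + 2 ^ d * M)"
  assume "\<not> ?thesis"
  then have large: "?B < (\<Sum>n=1..Q. len (?X n t) powr \<beta>)" if "t \<in> ?T" for t
    using that by (auto simp: not_le)
  have fin: "finite ?T" by (intro finite_PiE) auto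
  have cardT: "card ?T = Q ^ d" by (simp add: card_PiE)
  have "?T \<noteq> {}" using Q by (simp add: PiE_eq_empty_iff lessThan_empty_iff)
  have M0: "0 \<le> M" using M[of "{}"] by simp
  have level: "(\<Sum>t\<in>?T. len (?X n t) powr \<beta>) \<le> real (Q ^ d) * ((1 + 2 ^ d * M) / real n ^ 2)"
    if n: "1 \<le> n" "n \<le> Q" for n
  proof -
    \<comment> \<open>This threshold balances the two terms of \<open>powr_le_threshold\<close>:
      after summation over \<open>t\<close> both are of order
      \<open>Q ^ d * c powr \<beta>\<close>.\<close>
    define c where "c = 1 / real n ^ d"
    have c: "0 < c" using n by (simp add: c_def)
    have fib: "real (card {t \<in> ?T. ?X n t = v}) \<le> (2 * real Q / real n) ^ d" for v
    proof -
      have "{t \<in> ?T. ?X n t = v} \<subseteq> (\<Pi>\<^sub>E i\<in>{..<d}. {t \<in> {..<Q}. n * t div Q = v i})"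
      proof
        fix t assume "t \<in> {t \<in> ?T. ?X n t = v}"
        then have t: "t \<in> ?T" "?X n t = v" by auto
        have "n * t i div Q = v i" if "i < d" for i
          using that by (simp add: t(2)[symmetric] grid_path_def)
        then show "t \<in> (\<Pi>\<^sub>E i\<in>{..<d}. {t \<in> {..<Q}. n * t div Q = v i})"
          using t(1) by (simp add: PiE_iff)
      qed
      then have "card {t \<in> ?T. ?X n t = v} \<le> card (\<Pi>\<^sub>E i\<in>{..<d}. {t \<in> {..<Q}. n * t div Q = v i})"
        by (intro card_mono finite_PiE) auto
      also have "\<dots> = (\<Prod>i<d. card {t \<in> {..<Q}. n * t div Q = v i})"
        by (simp add: card_PiE)
      finally have "real (card {t \<in> ?T. ?X n t = v}) \<le> (\<Prod>i<d. real (card {t \<in> {..<Q}. n * t div Q = v i}))"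
        by (simp only: of_nat_prod[symmetric] of_nat_le_iff)
      also have "\<dots> \<le> (\<Prod>i<d. 2 * real Q / real n)"
        using card_div_fiber[OF n] by (intro prod_mono) auto
      finally show ?thesis by simp
    qed
    have X: "?X n ` ?T \<subseteq> (\<Pi>\<^sub>E i\<in>{..<d}. UNIV)" by (auto simp: grid_path_def)
    have sumX: "(\<Sum>t\<in>?T. len (?X n t)) \<le> (2 * real Q / real n) ^ d * M"
      by (rule sum_fiber_bound[where len = len and X = "?X n"]) (use fib len M[OF _ X] fin in auto)
    have "(\<Sum>t\<in>?T. len (?X n t) powr \<beta>) \<le> (\<Sum>t\<in>?T. c powr \<beta> + c powr (\<beta> - 1) * len (?X n t))"
      using \<beta> len c by (intro sum_mono powr_le_threshold) auto
    also have "\<dots> = real (Q ^ d) * c powr \<beta> + c powr (\<beta> - 1) * (\<Sum>t\<in>?T. len (?X n t))"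
      by (simp add: sum.distrib cardT sum_distrib_left)
    also have "\<dots> \<le> real (Q ^ d) * c powr \<beta> + c powr (\<beta> - 1) * ((2 * real Q / real n) ^ d * M)"
      using sumX by (intro add_left_mono mult_left_mono) auto
    also have "(2 * real Q / real n) ^ d = 2 ^ d * real (Q ^ d) * c"
      by (simp add: c_def power_divide power_mult_distrib)
    also have "c powr (\<beta> - 1) * (2 ^ d * real (Q ^ d) * c * M) = real (Q ^ d) * (2 ^ d * M) * c powr \<beta>"
    proof -
      have "c powr (\<beta> - 1) * c = c powr \<beta>" using c by (simp add: powr_diff)
      then show ?thesis by (simp add: mult_ac)
    qed
    also have "real (Q ^ d) * c powr \<beta> + \<dots> = real (Q ^ d) * ((1 + 2 ^ d * M) * c powr \<beta>)"
      by (simp add: algebra_simps)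
    \<comment> \<open>Here the size of \<open>d\<close> makes the bound summable over
      \<open>n\<close>.\<close>
    also have "c powr \<beta> \<le> 1 / real n ^ 2"
    proof -
      have "c powr \<beta> = real n powr (- (real d * \<beta>))"
        using n by (simp add: c_def powr_minus_divide powr_divide powr_powr flip: powr_realpow)
      also have "\<dots> \<le> real n powr (- 2)" using n d by (intro powr_mono) auto
      also have "\<dots> = 1 / real n ^ 2" using n by (simp add: powr_minus_divide)
      finally show ?thesis .
    qed
    finally show ?thesis using M0 by (simp add: mult_left_mono)
  qed
  have "real (Q ^ d) * ?B = (\<Sum>t\<in>?T. ?B)" by (simp add: cardT)
  also have "\<dots> < (\<Sum>t\<in>?T. \<Sum>n=1..Q. len (?X n t) powr \<beta>)"
    using fin \<open>?T \<noteq> {}\<close> large by (intro sum_strict_mono) auto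
  also have "\<dots> = (\<Sum>n=1..Q. \<Sum>t\<in>?T. len (?X n t) powr \<beta>)" by (rule sum.swap)
  also have "\<dots> \<le> (\<Sum>n=1..Q. real (Q ^ d) * ((1 + 2 ^ d * M) / real n ^ 2))"
    using level by (intro sum_mono) auto
  also have "\<dots> = real (Q ^ d) * ((1 + 2 ^ d * M) * (\<Sum>n=1..Q. 1 / real n ^ 2))"
    by (simp add: sum_distrib_left)
  also have "\<dots> \<le> real (Q ^ d) * ((1 + 2 ^ d * M) * 2)"
    using M0 order_trans[OF sum_inverse_squares_le, of Q 2] by (intro mult_left_mono) auto
  finally show False by (simp add: algebra_simps)
qed

section \<open>Smoothness and distortion\<close>

text \<open>For \<open>k = 1\<close> the class already gives the exponent \<open>\<alpha>\<close>;
  for \<open>k \<ge> 2\<close> the derivative is continuously differentiable, hence locally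
  Lipschitz, and \<open>min \<alpha> 1 = 1\<close>.\<close>

lemma class_C_1_plus_regular:
  assumes "class_C_1_plus \<alpha> f"
  shows "(f has_real_derivative deriv f x) (at x)" and "continuous_on UNIV (deriv f)"
    and "locally_Hoelder (min \<alpha> 1) (deriv f)"
proof -
  obtain k r where k: "1 \<le> k" "0 < r" "r \<le> 1" "1 + \<alpha> = real k + r"
    and C: "class_C k f" and H: "locally_Hoelder r ((deriv ^^ k) f)"
    using assms by (auto simp: class_C_1_plus_def)
  have diff: "(deriv ^^ i) f differentiable_on UNIV" if "i < k" for i
    using C that by (auto simp: class_C_def)
  have deriv: "((deriv ^^ i) f has_real_derivative (deriv ^^ Suc i) f x) (at x)" if "i < k" for i x
    using diff[OF that] by (auto simp: differentiable_on_def DERIV_deriv_iff_real_differentiable)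
  show "(f has_real_derivative deriv f x) (at x)"
    using deriv[of 0] k by simp
  have cont: "continuous_on UNIV ((deriv ^^ i) f)" if "i \<le> k" for i
    using that C differentiable_imp_continuous_on[OF diff] by (cases "i = k") (auto simp: class_C_def)
  from cont[of 1] k show "continuous_on UNIV (deriv f)" by simp
  show "locally_Hoelder (min \<alpha> 1) (deriv f)"
  proof (cases "k = 1")
    case True
    then show ?thesis using H k by simp
  next
    case False
    then have k2: "2 \<le> k" using k by simp
    then have \<alpha>: "min \<alpha> 1 = 1" using k by simp
    show ?thesis
      unfolding locally_Hoelder_def \<alpha>
    proof
      fix x
      have "compact ((deriv ^^ 2) f ` cball x 1)"
        using cont[OF k2] by (intro compact_continuous_image compact_cball) (rule continuous_on_subset, auto)
      then obtain C where C: "\<And>z. z \<in> cball x 1 \<Longrightarrow> \<bar>(deriv ^^ 2) f z\<bar> \<le> C"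
        using compact_imp_bounded by (fastforce simp: bounded_iff)
      have "norm (deriv f y - deriv f z) \<le> C * norm (y - z)" if "y \<in> ball x 1" "z \<in> ball x 1" for y z
      proof (rule field_differentiable_bound)
        show "convex (cball x 1)" by simp
        show "(deriv f has_field_derivative (deriv ^^ 2) f w) (at w within cball x 1)" for w
          using deriv[of 1 w] k2 by (simp add: has_field_derivative_at_within numeral_2_eq_2)
        show "norm ((deriv ^^ 2) f w) \<le> C" if "w \<in> cball x 1" for w using C[OF that] by simp
      qed (use that in auto)
      then show "\<exists>e>0. \<exists>C. \<forall>y\<in>ball x e. \<forall>z\<in>ball x e. \<bar>deriv f y - deriv f z\<bar> \<le> C * \<bar>y - z\<bar> powr 1"
        by (intro exI[of _ 1] conjI exI[of _ C]) auto
    qed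
  qed
qed

text \<open>A finite cover by balls of half radius puts every pair at distance less than
  \<open>\<delta>\<close> into one full ball; for the other pairs boundedness of \<open>f\<close> on
  \<open>S\<close> suffices.\<close>

lemma locally_Hoelder_imp_Hoelder_on_compact:
  assumes H: "locally_Hoelder r f" and cont: "continuous_on S f" and S: "compact S" and r: "0 < r"
  shows "\<exists>C\<ge>0. \<forall>y\<in>S. \<forall>z\<in>S. \<bar>f y - f z\<bar> \<le> C * \<bar>y - z\<bar> powr r"
proof -
  obtain e C where e: "\<And>x. 0 < e x"
    and C: "\<And>x y z. y \<in> ball x (e x) \<Longrightarrow> z \<in> ball x (e x) \<Longrightarrow> \<bar>f y - f z\<bar> \<le> C x * \<bar>y - z\<bar> powr r"
    using H unfolding locally_Hoelder_def by metis
  have cover: "S \<subseteq> (\<Union>x\<in>S. ball x (e x / 2))" using e by force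
  obtain T where T: "T \<subseteq> S" "finite T" "S \<subseteq> (\<Union>x\<in>T. ball x (e x / 2))"
    by (rule compactE_image[OF S _ cover]) auto
  \<comment> \<open>The inserted 1, and the 0 in \<open>C1\<close>, keep minimum and maximum defined
    when the cover is empty.\<close>
  define \<delta> where "\<delta> = Min (insert 1 ((\<lambda>x. e x / 2) ` T))"
  define C1 where "C1 = Max (insert 0 (C ` T))"
  have \<delta>: "\<delta> \<le> e x / 2" if "x \<in> T" for x
    unfolding \<delta>_def using T(2) that by (intro Min_le) auto
  have \<delta>0: "0 < \<delta>" using T(2) e by (auto simp: \<delta>_def)
  have C1: "0 \<le> C1" "\<And>x. x \<in> T \<Longrightarrow> C x \<le> C1" using T(2) by (auto simp: C1_def)
  obtain K where K: "\<And>y. y \<in> S \<Longrightarrow> \<bar>f y\<bar> \<le> K"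
    using compact_imp_bounded[OF compact_continuous_image[OF cont S]] by (fastforce simp: bounded_iff)
  show ?thesis
  proof (intro exI conjI ballI)
    show "0 \<le> max C1 (2 * K / \<delta> powr r)" using C1 by simp
    fix y z assume yz: "y \<in> S" "z \<in> S"
    show "\<bar>f y - f z\<bar> \<le> max C1 (2 * K / \<delta> powr r) * \<bar>y - z\<bar> powr r"
    proof (cases "\<bar>y - z\<bar> < \<delta>")
      case True
      obtain x where x: "x \<in> T" "y \<in> ball x (e x / 2)" using T(3) yz by blast
      have "z \<in> ball x (e x)" using x(2) True \<delta>[OF x(1)] unfolding mem_ball dist_real_def by linarith
      moreover have "y \<in> ball x (e x)" using x(2) e[of x] by auto
      ultimately have "\<bar>f y - f z\<bar> \<le> C x * \<bar>y - z\<bar> powr r" by (intro C)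
      also have "\<dots> \<le> max C1 (2 * K / \<delta> powr r) * \<bar>y - z\<bar> powr r"
        using C1(2)[OF x(1)] by (intro mult_right_mono) auto
      finally show ?thesis .
    next
      case False
      have K0: "0 \<le> K" using K[OF yz(1)] by simp
      have "\<bar>f y - f z\<bar> \<le> 2 * K" using K[OF yz(1)] K[OF yz(2)] by linarith
      also have "\<dots> = 2 * K / \<delta> powr r * \<delta> powr r" using \<delta>0 by simp
      also have "\<dots> \<le> 2 * K / \<delta> powr r * \<bar>y - z\<bar> powr r"
        using False \<delta>0 r K0 by (intro mult_left_mono powr_mono2) auto
      also have "\<dots> \<le> max C1 (2 * K / \<delta> powr r) * \<bar>y - z\<bar> powr r"
        by (intro mult_right_mono) auto
      finally show ?thesis .
    qed
  qed
qed

text \<open>By the chain rule the logarithm of the derivative is a sum along the orbit, and its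
  \<open>i\<close>-th term varies over \<open>I\<close> by at most
  \<open>C * l i powr \<beta>\<close>. The bound is kept in multiplicative form.\<close>

lemma distortion_of_composition:
  fixes s h :: "nat \<Rightarrow> real \<Rightarrow> real"
  assumes h: "h 0 = id" "\<And>i. h (Suc i) = s i \<circ> h i"
    and deriv: "\<And>i x. (s i has_real_derivative s' i x) (at x)" and pos: "\<And>i x. 0 < s' i x"
    and dist: "\<And>i x y. x \<in> J \<Longrightarrow> y \<in> J \<Longrightarrow> s' i x \<le> s' i y * exp (C * \<bar>x - y\<bar> powr \<beta>)"
    and maps: "\<And>i x. i < m \<Longrightarrow> x \<in> I \<Longrightarrow> h i x \<in> J"
    and len: "\<And>i x y. i < m \<Longrightarrow> x \<in> I \<Longrightarrow> y \<in> I \<Longrightarrow> \<bar>h i x - h i y\<bar> \<le> l i"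
    and C: "0 \<le> C" and \<beta>: "0 < \<beta>"
  shows "\<exists>h'. (\<forall>x. (h m has_real_derivative h' x) (at x) \<and> 0 < h' x) \<and>
    (\<forall>x\<in>I. \<forall>y\<in>I. h' x \<le> h' y * exp (C * (\<Sum>i<m. l i powr \<beta>)))"
  using maps len
proof (induction m)
  case 0
  then show ?case by (intro exI[of _ "\<lambda>_. 1"]) (auto simp: h id_def)
next
  case (Suc m)
  have "\<exists>h'. (\<forall>x. (h m has_real_derivative h' x) (at x) \<and> 0 < h' x) \<and>
    (\<forall>x\<in>I. \<forall>y\<in>I. h' x \<le> h' y * exp (C * (\<Sum>i<m. l i powr \<beta>)))"
    by (rule Suc.IH) (use Suc.prems in auto)
  then obtain h' where h': "\<And>x. (h m has_real_derivative h' x) (at x)" "\<And>x. 0 < h' x"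
      "\<And>x y. x \<in> I \<Longrightarrow> y \<in> I \<Longrightarrow> h' x \<le> h' y * exp (C * (\<Sum>i<m. l i powr \<beta>))"
    by blast
  show ?case
  proof (intro exI conjI allI ballI)
    fix x
    show "(h (Suc m) has_real_derivative s' m (h m x) * h' x) (at x)"
      unfolding h(2) by (intro DERIV_chain deriv h')
    show "0 < s' m (h m x) * h' x" using pos h' by simp
  next
    fix x y assume xy: "x \<in> I" "y \<in> I"
    have "s' m (h m x) \<le> s' m (h m y) * exp (C * \<bar>h m x - h m y\<bar> powr \<beta>)"
      using xy Suc.prems(1) by (intro dist) auto
    also have "\<dots> \<le> s' m (h m y) * exp (C * l m powr \<beta>)"
      using xy C \<beta> pos[of m "h m y"] Suc.prems(2)[of m x y]
      by (intro mult_left_mono iffD2[OF exp_le_cancel_iff] powr_mono2) auto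
    finally have "s' m (h m x) * h' x \<le>
        (s' m (h m y) * exp (C * l m powr \<beta>)) * (h' y * exp (C * (\<Sum>i<m. l i powr \<beta>)))"
      using h'(2)[of x] h'(3)[OF xy] pos[of m "h m y"] by (intro mult_mono) (auto intro: less_imp_le)
    also have "\<dots> = s' m (h m y) * h' y * exp (C * (\<Sum>i<Suc m. l i powr \<beta>))"
      by (simp add: exp_add distrib_left)
    finally show "s' m (h m x) * h' x \<le> s' m (h m y) * h' y * exp (C * (\<Sum>i<Suc m. l i powr \<beta>))" .
  qed
qed

section \<open>Groups of maps with Hoelder continuous derivative\<close>

locale smooth_line_group = line_group +
  fixes \<beta> :: real
  assumes \<beta>: "0 < \<beta>" "\<beta> \<le> 1"
    and has_deriv: "g \<in> G \<Longrightarrow> (g has_real_derivative deriv g x) (at x)"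
    and continuous_deriv: "g \<in> G \<Longrightarrow> continuous_on UNIV (deriv g)"
    and Hoelder_deriv: "g \<in> G \<Longrightarrow> locally_Hoelder \<beta> (deriv g)"
begin

text \<open>An increasing map has nonnegative derivative; it cannot vanish because the inverse is
  differentiable as well and the two derivatives multiply to 1.\<close>

lemma deriv_pos: "g \<in> G \<Longrightarrow> 0 < deriv g x"
proof -
  assume g: "g \<in> G"
  have "mono g" using strict_mono_mem[OF g] by (rule strict_mono_mono)
  then have "0 \<le> deriv g x"
    by (intro mono_on_imp_deriv_nonneg[of UNIV g _ x] has_deriv g) auto
  moreover have "(finv g \<circ> g has_real_derivative deriv (finv g) (g x) * deriv g x) (at x)"
    by (intro DERIV_chain has_deriv inv_mem g)
  then have "((\<lambda>x. x) has_real_derivative deriv (finv g) (g x) * deriv g x) (at x)"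
    using g by (simp add: comp_def inv_app)
  then have "deriv (finv g) (g x) * deriv g x = 1"
    using DERIV_unique[OF _ DERIV_ident] by blast
  ultimately show ?thesis by (metis less_eq_real_def mult_zero_right zero_neq_one)
qed

text \<open>A Hoelder bound for the logarithm of \<open>deriv g\<close>: the constant is a Hoelder
  constant of \<open>deriv g\<close> divided by its minimum, and \<open>1 + t \<le> exp t\<close>
  gives the multiplicative form.\<close>

lemma deriv_ratio_bound:
  assumes g: "g \<in> G"
  shows "\<exists>C\<ge>0. \<forall>x\<in>{A..B}. \<forall>y\<in>{A..B}. deriv g x \<le> deriv g y * exp (C * \<bar>x - y\<bar> powr \<beta>)"
proof (cases "A \<le> B")
  case True
  have cont: "continuous_on {A..B} (deriv g)"
    using continuous_deriv[OF g] continuous_on_subset by blast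
  obtain C where C: "0 \<le> C" "\<And>x y. x \<in> {A..B} \<Longrightarrow> y \<in> {A..B} \<Longrightarrow> \<bar>deriv g x - deriv g y\<bar> \<le> C * \<bar>x - y\<bar> powr \<beta>"
    using locally_Hoelder_imp_Hoelder_on_compact[OF Hoelder_deriv[OF g] cont _ \<beta>(1)] by auto
  have "{A..B} \<noteq> {}" using True by simp
  then obtain z where z: "\<And>y. y \<in> {A..B} \<Longrightarrow> deriv g z \<le> deriv g y"
    using continuous_attains_inf[OF compact_Icc _ cont] by blast
  define m where "m = deriv g z"
  have m: "0 < m" by (simp add: m_def deriv_pos[OF g])
  show ?thesis
  proof (intro exI conjI ballI)
    show "0 \<le> C / m" using C m by simp
    fix x y assume xy: "x \<in> {A..B}" "y \<in> {A..B}"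
    let ?t = "\<bar>x - y\<bar> powr \<beta>"
    have "deriv g x \<le> deriv g y + C * ?t" using C(2)[OF xy] by linarith
    also have "C * ?t = m * (C / m * ?t)" using m by simp
    also have "\<dots> \<le> deriv g y * (C / m * ?t)"
      using z[OF xy(2)] C m by (intro mult_right_mono) (auto simp: m_def)
    also have "deriv g y + deriv g y * (C / m * ?t) = deriv g y * (1 + C / m * ?t)"
      by (simp add: distrib_left)
    also have "\<dots> \<le> deriv g y * exp (C / m * ?t)"
      using deriv_pos[OF g, of y] by (intro mult_left_mono exp_ge_add_one_self) auto
    finally show "deriv g x \<le> deriv g y * exp (C / m * ?t)" by simp
  qed
qed (auto intro: exI[of _ 0])

lemma deriv_ratio_bound_finite:
  assumes "finite S" "S \<subseteq> G"
  shows "\<exists>C\<ge>0. \<forall>g\<in>S. \<forall>x\<in>{A..B}. \<forall>y\<in>{A..B}. deriv g x \<le> deriv g y * exp (C * \<bar>x - y\<bar> powr \<beta>)"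
  using assms
proof (induction S rule: finite_induct)
  case (insert g S)
  then obtain C where C: "0 \<le> C" "\<And>h x y. h \<in> S \<Longrightarrow> x \<in> {A..B} \<Longrightarrow> y \<in> {A..B} \<Longrightarrow>
      deriv h x \<le> deriv h y * exp (C * \<bar>x - y\<bar> powr \<beta>)" by auto
  obtain D where D: "0 \<le> D" "\<And>x y. x \<in> {A..B} \<Longrightarrow> y \<in> {A..B} \<Longrightarrow>
      deriv g x \<le> deriv g y * exp (D * \<bar>x - y\<bar> powr \<beta>)"
    using deriv_ratio_bound[of g A B] insert.prems by auto
  show ?case
  proof (intro exI conjI ballI)
    show "0 \<le> max C D" using C by simp
    fix h x y assume h: "h \<in> insert g S" and xy: "x \<in> {A..B}" "y \<in> {A..B}"
    obtain c where c: "c \<le> max C D" "deriv h x \<le> deriv h y * exp (c * \<bar>x - y\<bar> powr \<beta>)"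
    proof (cases "h = g")
      case True
      then show thesis using that[of D] D(2)[OF xy] by simp
    next
      case False
      then show thesis using that[of C] C(2)[OF _ xy, of h] h by simp
    qed
    note c(2)
    also have "deriv h y * exp (c * \<bar>x - y\<bar> powr \<beta>) \<le> deriv h y * exp (max C D * \<bar>x - y\<bar> powr \<beta>)"
      using c(1) h insert.prems deriv_pos[of h y]
      by (intro mult_left_mono iffD2[OF exp_le_cancel_iff] mult_right_mono) (auto intro: less_imp_le)
    finally show "deriv h x \<le> deriv h y * exp (max C D * \<bar>x - y\<bar> powr \<beta>)" .
  qed
qed (auto intro: exI[of _ 0])

end

section \<open>Nested levels\<close>

locale abelian_level = line_group +
  fixes F :: "real set"
  assumes closed_F: "closed F" and F_ne: "F \<noteq> {}"
    and F_inv: "g \<in> G \<Longrightarrow> x \<in> F \<Longrightarrow> g x \<in> F"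
    and comm: "g \<in> G \<Longrightarrow> h \<in> G \<Longrightarrow> x \<in> F \<Longrightarrow> g (h x) = h (g x)"
    and no_global: "\<exists>g\<in>G. g x \<noteq> x"
    and has_fixed: "g \<in> G \<Longrightarrow> \<exists>x. g x = x"
begin

text \<open>The supremum of an orbit bounded above would be fixed by every element.\<close>

lemma orbit_above: "\<exists>g\<in>G. y < g x"
proof (rule ccontr)
  assume "\<not> ?thesis"
  then have bound: "g x \<le> y" if "g \<in> G" for g using that by (auto simp: not_less)
  define s where "s = Sup ((\<lambda>g. g x) ` G)"
  have upper: "g x \<le> s" if "g \<in> G" for g
    unfolding s_def using that bound by (intro cSup_upper) (auto intro: bdd_aboveI2[where M = y])
  have le: "s \<le> h s" if h: "h \<in> G" for h
    unfolding s_def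
  proof (rule cSup_least)
    show "(\<lambda>g. g x) ` G \<noteq> {}" using id_mem by blast
    fix z assume "z \<in> (\<lambda>g. g x) ` G"
    then obtain g where g: "g \<in> G" "z = g x" by blast
    have "(finv h \<circ> g) x \<le> s" by (intro upper comp_mem inv_mem h g)
    then show "z \<le> h (Sup ((\<lambda>g. g x) ` G))" using g(2) by (simp add: inv_le_iff[OF h] s_def)
  qed
  have "g s = s" if g: "g \<in> G" for g
    using le[OF g] le[OF inv_mem[OF g]] by (simp add: le_inv_iff[OF g])
  then show False using no_global by blast
qed

lemma orbit_below: "\<exists>g\<in>G. g x < y"
proof -
  obtain g where g: "g \<in> G" "x < g y" using orbit_above by blast
  then have "finv g x < y" by (simp add: inv_less_iff)
  then show ?thesis using inv_mem[OF g(1)] by blast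
qed

text \<open>Any fixed point \<open>y\<close> yields one in \<open>F\<close>, namely the last point
  of \<open>F\<close> up to \<open>y\<close>: both \<open>g\<close> and its inverse preserve
  \<open>F\<close> and the half-line ending at \<open>y\<close>.\<close>

lemma fixed_in_F:
  assumes g: "g \<in> G"
  shows "\<exists>p\<in>F. g p = p"
proof -
  obtain y where y: "g y = y" using has_fixed[OF g] by blast
  obtain x0 where "x0 \<in> F" using F_ne by blast
  moreover obtain h where "h \<in> G" "h x0 < y" using orbit_below by blast
  ultimately have ne: "F \<inter> {..y} \<noteq> {}" using F_inv[of h x0] by force
  have bdd: "bdd_above (F \<inter> {..y})" by (rule bdd_aboveI[of _ y]) auto
  define p where "p = Sup (F \<inter> {..y})"
  have p: "p \<in> F \<inter> {..y}"
    unfolding p_def using ne bdd closed_F by (intro closed_contains_Sup) auto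
  have le: "k p \<le> p" if k: "k \<in> G" "k y = y" for k
  proof -
    have "k p \<le> k y" using p le_iff[OF k(1)] by simp
    then have "k p \<in> F \<inter> {..y}" using p k F_inv by auto
    then show ?thesis unfolding p_def using bdd by (intro cSup_upper)
  qed
  have "finv g y = y" using y by (simp add: inv_eq_iff[OF g])
  then have "p \<le> g p" using le[OF inv_mem[OF g]] by (simp add: inv_le_iff[OF g])
  then show ?thesis using le[OF g y] p by (intro bexI[of _ p]) auto
qed

definition fixset :: "(real \<Rightarrow> real) \<Rightarrow> real set" where
  "fixset g = {x \<in> F. g x = x}"

lemma closed_fixset: "g \<in> G \<Longrightarrow> closed (fixset g)"
proof -
  assume g: "g \<in> G"
  have "fixset g = F \<inter> {x. g x = x}" by (auto simp: fixset_def)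
  then show ?thesis
    using closed_F continuous_mem[OF g] by (auto intro!: closed_Int closed_Collect_eq continuous_intros)
qed

lemma fixset_inv: "g \<in> G \<Longrightarrow> h \<in> G \<Longrightarrow> x \<in> fixset g \<Longrightarrow> h x \<in> fixset g"
  using comm[of g h x] F_inv[of h x] by (auto simp: fixset_def)

lemma fixset_unbounded:
  assumes g: "g \<in> G"
  shows "\<exists>p\<in>fixset g. p < x" and "\<exists>p\<in>fixset g. x < p"
proof -
  obtain p where p: "p \<in> fixset g" using fixed_in_F[OF g] by (auto simp: fixset_def)
  show "\<exists>p\<in>fixset g. p < x" using orbit_below[of p x] fixset_inv[OF g _ p] by blast
  show "\<exists>p\<in>fixset g. x < p" using orbit_above[of x p] fixset_inv[OF g _ p] by blast
qed

text \<open>The interval is a gap of \<open>fixset g\<close>, not of \<open>F\<close>: points of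
  \<open>F\<close> moved by \<open>g\<close> may lie inside.\<close>

definition adj :: "(real \<Rightarrow> real) \<Rightarrow> real \<Rightarrow> real \<Rightarrow> bool" where
  "adj g a b \<longleftrightarrow> a < b \<and> a \<in> fixset g \<and> b \<in> fixset g \<and> (\<forall>x\<in>fixset g. x \<le> a \<or> b \<le> x)"

lemma adj_exists:
  assumes g: "g \<in> G" and x: "x \<in> F" "g x \<noteq> x"
  shows "\<exists>a b. adj g a b \<and> a < x \<and> x < b"
proof (intro exI conjI)
  define a where "a = Sup (fixset g \<inter> {..x})"
  define b where "b = Inf (fixset g \<inter> {x..})"
  have bdd: "bdd_above (fixset g \<inter> {..x})" "bdd_below (fixset g \<inter> {x..})"
    by (auto intro: bdd_aboveI[of _ x] bdd_belowI[of _ x])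
  have ne: "fixset g \<inter> {..x} \<noteq> {}" "fixset g \<inter> {x..} \<noteq> {}"
    using fixset_unbounded[OF g, of x] by force+
  have a: "a \<in> fixset g \<inter> {..x}"
    unfolding a_def using ne bdd closed_fixset[OF g] by (intro closed_contains_Sup) auto
  have b: "b \<in> fixset g \<inter> {x..}"
    unfolding b_def using ne bdd closed_fixset[OF g] by (intro closed_contains_Inf) auto
  have "x \<notin> fixset g" using x by (simp add: fixset_def)
  then show ax: "a < x" and xb: "x < b" using a b by (auto simp: less_le)
  have "y \<le> a \<or> b \<le> y" if "y \<in> fixset g" for y
    using that bdd unfolding a_def b_def
    by (cases "y \<le> x") (auto intro: cSup_upper cInf_lower)
  then show "adj g a b" using a b ax xb by (auto simp: adj_def)
qed

text \<open>\<open>h\<close> and its inverse preserve \<open>fixset g\<close>, so \<open>h\<close>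
  permutes the gaps; a gap and its image coincide or do not overlap.\<close>

lemma adj_image:
  assumes adj: "adj g a b" and g: "g \<in> G" and h: "h \<in> G"
  shows "h a = a \<and> h b = b \<or> h b \<le> a \<or> b \<le> h a"
proof -
  have fix1: "k a \<in> fixset g" "k b \<in> fixset g" if "k \<in> G" for k
    using adj fixset_inv[OF g that] by (auto simp: adj_def)
  have gap: "y \<le> a \<or> b \<le> y" if "y \<in> fixset g" for y
    using adj that by (auto simp: adj_def)
  show ?thesis
    using gap[OF fix1(1)[OF h]] gap[OF fix1(2)[OF h]]
      gap[OF fix1(1)[OF inv_mem[OF h]]] gap[OF fix1(2)[OF inv_mem[OF h]]]
    unfolding inv_le_iff[OF h] le_inv_iff[OF h] by linarith
qed

text \<open>An element that moves \<open>b\<close> to the right has a gap of its own around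
  \<open>b\<close>; it serves as the next level.\<close>

lemma adj_step:
  assumes adj: "adj g a b" and g: "g \<in> G"
  shows "\<exists>g' a' b'. g' \<in> G \<and> adj g' a' b' \<and> b < g' b \<and> a' < b \<and> b < b'"
proof -
  obtain h where h: "h \<in> G" "b < h b" using orbit_above by blast
  have "b \<in> F" using adj by (simp add: adj_def fixset_def)
  then show ?thesis using adj_exists[OF h(1), of b] h by force
qed

end

section \<open>Nested chains of gaps and their words\<close>

locale level_chain = abelian_level +
  fixes gen :: "nat \<Rightarrow> real \<Rightarrow> real" and lo hi :: "nat \<Rightarrow> real"
  assumes gen_mem: "gen n \<in> G" and adj: "adj (gen n) (lo n) (hi n)"
    and gen_moves: "hi n < gen (Suc n) (hi n)"
    and lo_less: "lo (Suc n) < hi n" and hi_less: "hi n < hi (Suc n)"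
begin

lemma lo_less_hi: "lo n < hi n"
  using adj by (simp add: adj_def)

lemma lo_in_F: "lo n \<in> F" and hi_in_F: "hi n \<in> F"
  using adj[of n] by (auto simp: adj_def fixset_def)

text \<open>Inductively \<open>gen j\<close> fixes \<open>hi i\<close>, which is interior to the
  next gap; that gap thus overlaps its image, and \<open>adj_image\<close> makes its ends
  fixed.\<close>

lemma gen_fixes_ends: "j \<le> i \<Longrightarrow> gen j (lo i) = lo i \<and> gen j (hi i) = hi i"
proof (induction rule: dec_induct)
  case base
  then show ?case using adj[of j] by (auto simp: adj_def fixset_def)
next
  case (step i)
  have "gen j (hi i) < gen j (hi (Suc i))" "gen j (lo (Suc i)) < gen j (hi i)"
    using lo_less hi_less less_iff[OF gen_mem] by auto
  then show ?case
    using adj_image[OF adj gen_mem gen_mem[of j], of "Suc i"] step.IH lo_less[of i] hi_less[of i] by auto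
qed

text \<open>\<open>lo (Suc n)\<close> is a fixed point of \<open>gen n\<close> in \<open>F\<close>,
  so it is not inside the gap of \<open>gen n\<close>; being below \<open>hi n\<close>, it lies on
  the left.\<close>

lemma lo_antimono: "i \<le> j \<Longrightarrow> lo j \<le> lo i"
proof (rule lift_Suc_antimono_le[of lo])
  fix n
  have "lo (Suc n) \<in> fixset (gen n)"
    using gen_fixes_ends[of n "Suc n"] lo_in_F by (simp add: fixset_def)
  then show "lo (Suc n) \<le> lo n" using adj[of n] lo_less[of n] by (auto simp: adj_def)
qed

lemma hi_mono: "i \<le> j \<Longrightarrow> hi i \<le> hi j"
  by (rule lift_Suc_mono_le[of hi]) (use hi_less in \<open>auto simp: less_imp_le\<close>)

text \<open>Positive powers of \<open>gen (Suc i)\<close> move \<open>hi i\<close> to the right, so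
  the gap of level \<open>i\<close> is not preserved, and \<open>adj_image\<close> places its image
  wholly to the right.\<close>

lemma gen_displaces:
  assumes "0 < m"
  shows "hi i \<le> (gen (Suc i) ^^ m) (lo i)"
proof -
  let ?g = "gen (Suc i)"
  have "hi i < (?g ^^ Suc k) (hi i)" for k
  proof (induction k)
    case (Suc k)
    have "?g (hi i) < ?g ((?g ^^ Suc k) (hi i))" using Suc less_iff[OF gen_mem] by blast
    then show ?case using gen_moves[of i] by simp
  qed (simp add: gen_moves)
  then have "hi i < (?g ^^ m) (hi i)" using assms gr0_conv_Suc by auto
  then show ?thesis
    using adj_image[OF adj[of i] gen_mem funpow_mem[OF gen_mem[of "Suc i"], of m]] lo_less_hi[of i] by auto
qed

text \<open>The exponent \<open>v i\<close> belongs to \<open>gen (Suc i)\<close>: the element \<open>gen 0\<close> is not used, it is the one shown to be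
  trivial on \<open>{lo 0..hi 0} \<inter> F\<close>.\<close>

primrec word :: "nat \<Rightarrow> (nat \<Rightarrow> nat) \<Rightarrow> real \<Rightarrow> real" where
  "word 0 v = id"
| "word (Suc d) v = gen (Suc d) ^^ v d \<circ> word d v"

lemma word_mem: "word d v \<in> G"
  by (induction d) (simp_all only: word.simps id_mem comp_mem funpow_mem gen_mem)

lemma word_cong: "(\<And>i. i < d \<Longrightarrow> v i = w i) \<Longrightarrow> word d v = word d w"
  by (induction d) auto

lemma word_zero: "(\<And>i. i < d \<Longrightarrow> v i = 0) \<Longrightarrow> word d v = id"
  by (induction d) auto

lemma word_add:
  assumes "x \<in> F"
  shows "word d (\<lambda>i. v i + w i) x = word d w (word d v x)"
proof (induction d)
  case (Suc d)
  let ?g = "gen (Suc d)"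
  have "word (Suc d) (\<lambda>i. v i + w i) x = (?g ^^ w d) ((?g ^^ v d) (word d w (word d v x)))"
    using Suc by (simp add: funpow_add add.commute[of "v d"])
  also have "(?g ^^ v d) (word d w (word d v x)) = word d w ((?g ^^ v d) (word d v x))"
    by (rule comm[OF funpow_mem[OF gen_mem] word_mem F_inv[OF word_mem assms]])
  finally show ?case by simp
qed simp

lemma funpow_gen_fixes: "j \<le> i \<Longrightarrow> (gen j ^^ n) (lo i) = lo i \<and> (gen j ^^ n) (hi i) = hi i"
  by (induction n) (auto simp: gen_fixes_ends)

lemma word_range:
  assumes "lo 0 \<le> x" "x \<le> hi 0"
  shows "lo d \<le> word d v x \<and> word d v x \<le> hi d"
proof (induction d)
  case (Suc d)
  let ?h = "gen (Suc d) ^^ v d"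
  have h: "?h \<in> G" by (intro funpow_mem gen_mem)
  have "lo (Suc d) \<le> word d v x" "word d v x \<le> hi (Suc d)"
    using Suc lo_antimono[of d "Suc d"] hi_mono[of d "Suc d"] by auto
  then have "?h (lo (Suc d)) \<le> ?h (word d v x)" "?h (word d v x) \<le> ?h (hi (Suc d))"
    by (simp_all only: le_iff[OF h])
  then show ?case using funpow_gen_fixes[of "Suc d" "Suc d" "v d"] by simp
qed (use assms in simp)

text \<open>The largest index at which the exponents differ decides: its generator separates the
  images of the whole interval of that level, and later generators apply the same increasing map to
  both.\<close>

lemma word_disjoint:
  assumes "i < d" "v i \<noteq> w i"
  shows "word d v (hi 0) \<le> word d w (lo 0) \<or> word d w (hi 0) \<le> word d v (lo 0)"
  using assms(1)
proof (induction d)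
  case (Suc d)
  let ?g = "gen (Suc d)"
  have less: "word (Suc d) v (hi 0) \<le> word (Suc d) w (lo 0)" if "v d < w d" for v w
  proof -
    have "word d v (hi 0) \<le> hi d" "lo d \<le> word d w (lo 0)"
      using word_range lo_less_hi[of 0] by auto
    have "word (Suc d) v (hi 0) \<le> (?g ^^ v d) (hi d)"
      using \<open>word d v (hi 0) \<le> hi d\<close> by (simp add: le_iff[OF funpow_mem[OF gen_mem]])
    also have "\<dots> \<le> (?g ^^ v d) ((?g ^^ (w d - v d)) (lo d))"
      using gen_displaces[of "w d - v d" d] that by (simp add: le_iff[OF funpow_mem[OF gen_mem]])
    also have "\<dots> = (?g ^^ w d) (lo d)"
      using funpow_add[of "v d" "w d - v d" ?g] that by simp
    also have "\<dots> \<le> word (Suc d) w (lo 0)"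
      using \<open>lo d \<le> word d w (lo 0)\<close> by (simp add: le_iff[OF funpow_mem[OF gen_mem]])
    finally show ?thesis .
  qed
  show ?case
  proof (cases "v d = w d")
    case True
    then have "i < d" using Suc.prems assms(2) by (metis less_Suc_eq)
    then show ?thesis using Suc.IH True by (simp add: le_iff[OF funpow_mem[OF gen_mem]])
  next
    case False
    then show ?thesis using less[of v w] less[of w v] by linarith
  qed
qed simp

lemma word_total_length:
  assumes V: "finite V" "V \<subseteq> (\<Pi>\<^sub>E i\<in>{..<d}. UNIV)"
  shows "(\<Sum>v\<in>V. word d v (hi 0) - word d v (lo 0)) \<le> hi d - lo d"
proof -
  \<comment> \<open>Half-open intervals, since images of \<open>{lo 0..hi 0}\<close> may share an
    endpoint.\<close>
  let ?I = "\<lambda>v. {word d v (lo 0)..<word d v (hi 0)}"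
  have le: "word d v (lo 0) \<le> word d v (hi 0)" for v
    using lo_less_hi[of 0] le_iff[OF word_mem] by simp
  have "disjoint_family_on ?I V"
  unfolding disjoint_family_on_def
  proof (intro ballI impI)
    fix v w assume vw: "v \<in> V" "w \<in> V" "v \<noteq> w"
    have "v \<in> (\<Pi>\<^sub>E i\<in>{..<d}. UNIV)" "w \<in> (\<Pi>\<^sub>E i\<in>{..<d}. UNIV)" using vw V(2) by auto
    then have "\<exists>i\<in>{..<d}. v i \<noteq> w i" using PiE_ext[of v "{..<d}" "\<lambda>_. UNIV" w] vw(3) by blast
    then obtain i where "i < d" "v i \<noteq> w i" by blast
    from word_disjoint[of _ _ v w, OF this] show "?I v \<inter> ?I w = {}" by auto
  qed
  then have "measure lborel (\<Union>v\<in>V. ?I v) = (\<Sum>v\<in>V. measure lborel (?I v))"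
    by (intro measure_finite_Union V) (auto simp: le)
  then have "(\<Sum>v\<in>V. word d v (hi 0) - word d v (lo 0)) = measure lborel (\<Union>v\<in>V. ?I v)"
    using le by simp
  also have "\<dots> \<le> measure lborel {lo d..hi d}"
  proof (intro measure_mono_fmeasurable)
    have "lo d \<le> word d v (lo 0)" "word d v (hi 0) \<le> hi d" for v
      using word_range[of "lo 0" d v] word_range[of "hi 0" d v] lo_less_hi[of 0] by auto
    then have "?I v \<subseteq> {lo d..hi d}" for v
      by (simp add: atLeastLessThan_subseteq_atLeastAtMost_iff)
    then show "(\<Union>v\<in>V. ?I v) \<subseteq> {lo d..hi d}" by blast
    show "(\<Union>v\<in>V. ?I v) \<in> sets lborel" using V(1) by auto
    show "{lo d..hi d} \<in> fmeasurable lborel"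
      using lo_less_hi[of d] by (intro fmeasurableI) auto
  qed
  also have "\<dots> = hi d - lo d" using lo_less_hi[of d] by simp
  finally show ?thesis .
qed

end

section \<open>Kopell's argument along words of bounded distortion\<close>

locale smooth_level_chain = level_chain + smooth_line_group
begin

text \<open>The words follow a grid path. A long enough path reaches an interval shorter than
  \<open>\<delta>\<close>, while the sum of the \<open>\<beta>\<close>-th powers of the lengths
  stays bounded independently of the path, so \<open>E\<close> can be chosen before
  \<open>\<delta>\<close>.\<close>

lemma bounded_distortion_words:
  assumes d: "2 \<le> real d * \<beta>"
  shows "\<exists>E\<ge>1. \<forall>\<delta>>0. \<exists>h\<in>G. lo d \<le> h (lo 0) \<and> h (hi 0) \<le> hi d \<and> h (hi 0) - h (lo 0) < \<delta> \<and>
    (\<exists>h'. (\<forall>x. (h has_real_derivative h' x) (at x) \<and> 0 < h' x) \<and>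
      (\<forall>x\<in>{lo 0..hi 0}. \<forall>y\<in>{lo 0..hi 0}. h' x \<le> h' y * E))"
proof -
  define M where "M = hi d - lo d"
  define len where "len v = word d v (hi 0) - word d v (lo 0)" for v
  have len_pos: "0 < len v" for v
    using lo_less_hi[of 0] less_iff[OF word_mem] by (simp add: len_def)
  have M: "sum len V \<le> M" if "finite V" "V \<subseteq> (\<Pi>\<^sub>E i\<in>{..<d}. UNIV)" for V
    using word_total_length[OF that] by (simp add: len_def M_def)
  \<comment> \<open>Grid paths advance by vectors with entries 0 and 1, so finitely many step maps
    occur and one constant \<open>C\<close> serves for all.\<close>
  define D :: "(nat \<Rightarrow> nat) set" where "D = (\<Pi>\<^sub>E i\<in>{..<d}. {0, 1})"
  have "finite D" unfolding D_def by (intro finite_PiE) auto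
  then have "finite (word d ` D)" "word d ` D \<subseteq> G" using word_mem by auto
  from deriv_ratio_bound_finite[OF this, of "lo d" "hi d"] obtain C where C0: "0 \<le> C"
    and C': "\<forall>g\<in>word d ` D. \<forall>x\<in>{lo d..hi d}. \<forall>y\<in>{lo d..hi d}.
      deriv g x \<le> deriv g y * exp (C * \<bar>x - y\<bar> powr \<beta>)" by blast
  have C: "deriv (word d e) x \<le> deriv (word d e) y * exp (C * \<bar>x - y\<bar> powr \<beta>)"
    if "e \<in> D" "x \<in> {lo d..hi d}" "y \<in> {lo d..hi d}" for e x y
    using C' that by blast
  define K where "K = 2 * (1 + 2 ^ d * M)"
  \<comment> \<open>The contribution of time 0, which the sum in
    \<open>grid_path_sum_bounded\<close> omits.\<close>
  define l0 where "l0 = (hi 0 - lo 0) powr \<beta>"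
  have K: "0 < K" using lo_less_hi[of d] by (auto simp: K_def M_def intro!: add_pos_nonneg)
  have "\<exists>h\<in>G. lo d \<le> h (lo 0) \<and> h (hi 0) \<le> hi d \<and> h (hi 0) - h (lo 0) < \<delta> \<and>
    (\<exists>h'. (\<forall>x. (h has_real_derivative h' x) (at x) \<and> 0 < h' x) \<and>
      (\<forall>x\<in>{lo 0..hi 0}. \<forall>y\<in>{lo 0..hi 0}. h' x \<le> h' y * exp (C * (l0 + K))))" if \<delta>: "0 < \<delta>" for \<delta>
  proof -
    \<comment> \<open>For this \<open>Q\<close> the mean of the \<open>\<beta>\<close>-th powers
      along the path is below \<open>\<delta> powr \<beta>\<close>, so some interval is shorter than
      \<open>\<delta>\<close>.\<close>
    obtain Q where Q: "K / \<delta> powr \<beta> < real Q" using reals_Archimedean2 by blast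
    have "0 < K / \<delta> powr \<beta>" using K \<delta> by simp
    then have Q0: "0 < Q" using Q by (cases "Q = 0") auto
    obtain t where t: "t \<in> (\<Pi>\<^sub>E i\<in>{..<d}. {..<Q})"
      and sum: "(\<Sum>n=1..Q. len (grid_path d Q t n) powr \<beta>) \<le> K"
      using grid_path_sum_bounded[OF \<beta> d, of Q len M] Q0 len_pos M unfolding K_def
      by (auto simp: less_imp_le)
    define X where "X = grid_path d Q t"
    have "\<exists>n\<in>{1..Q}. len (X n) powr \<beta> < \<delta> powr \<beta>"
    proof (rule ccontr)
      assume "\<not> ?thesis"
      then have "(\<Sum>n=1..Q. \<delta> powr \<beta>) \<le> (\<Sum>n=1..Q. len (X n) powr \<beta>)"
        by (intro sum_mono) (auto simp: not_less)
      also have "\<dots> \<le> K" using sum by (simp add: X_def)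
      finally show False using Q \<delta> by (simp add: field_simps)
    qed
    then obtain n where n: "1 \<le> n" "n \<le> Q" "len (X n) powr \<beta> < \<delta> powr \<beta>" by auto
    have lenn: "len (X n) < \<delta>"
      using n(3) powr_mono2[of \<beta> \<delta> "len (X n)"] \<beta> \<delta> by (cases "len (X n) < \<delta>") auto
    define e where "e m = (\<lambda>i\<in>{..<d}. X (Suc m) i - X m i)" for m
    have step: "X m i \<le> X (Suc m) i" "X (Suc m) i - X m i \<le> 1" if "i < d" for m i
    proof -
      have ti: "t i < Q" using t that by auto
      have X: "X m i = m * t i div Q" for m using that by (simp add: X_def grid_path_def)
      show "X m i \<le> X (Suc m) i" unfolding X by (intro div_le_mono) simp
      have "Suc m * t i div Q \<le> (m * t i + Q) div Q" using ti by (intro div_le_mono) simp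
      also have "\<dots> = m * t i div Q + 1" using Q0 by simp
      finally show "X (Suc m) i - X m i \<le> 1" unfolding X by simp
    qed
    have eD: "e m \<in> D" for m
      unfolding D_def
    proof (rule PiE_I)
      fix i assume "i \<in> {..<d}"
      then show "e m i \<in> {0, 1}" using step(2)[of i m] by (auto simp: e_def)
    qed (simp add: e_def)
    \<comment> \<open>The composition of the step maps is compared with \<open>word d (X m)\<close>
      only on \<open>F\<close>, which suffices because \<open>lo 0\<close> and \<open>hi 0\<close>
      lie in \<open>F\<close>.\<close>
    define h where "h = rec_nat id (\<lambda>m h. word d (e m) \<circ> h)"
    have h0: "h 0 = id" and hS: "h (Suc m) = word d (e m) \<circ> h m" for m by (auto simp: h_def)
    have hG: "h m \<in> G" for m
      by (induction m) (simp_all only: h0 hS id_mem comp_mem word_mem)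
    have hX: "h m x = word d (X m) x" if "x \<in> F" for m x
    proof (induction m)
      case 0
      have "word d (X 0) = id" by (rule word_zero) (simp add: X_def grid_path_def)
      then show ?case by (simp add: h0)
    next
      case (Suc m)
      have "word d (X (Suc m)) = word d (\<lambda>i. X m i + e m i)"
        using step(1) by (intro word_cong) (simp add: e_def)
      then show ?case using word_add[OF that] Suc by (simp add: hS)
    qed
    have range: "lo d \<le> h m (lo 0)" "h m (hi 0) \<le> hi d" for m
      using word_range[of "lo 0" d "X m"] word_range[of "hi 0" d "X m"] lo_less_hi[of 0]
      by (auto simp: hX lo_in_F hi_in_F)
    have lenh: "h m (hi 0) - h m (lo 0) = len (X m)" for m
      by (simp add: hX lo_in_F hi_in_F len_def)
    have mono: "h m (lo 0) \<le> h m x" "h m x \<le> h m (hi 0)" if "x \<in> {lo 0..hi 0}" for m x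
      using that by (auto simp: le_iff[OF hG])
    have "\<exists>h'. (\<forall>x. (h n has_real_derivative h' x) (at x) \<and> 0 < h' x) \<and>
      (\<forall>x\<in>{lo 0..hi 0}. \<forall>y\<in>{lo 0..hi 0}. h' x \<le> h' y * exp (C * (\<Sum>i<n. len (X i) powr \<beta>)))"
    proof (rule distortion_of_composition[where s = "\<lambda>m. word d (e m)" and s' = "\<lambda>m. deriv (word d (e m))"
          and J = "{lo d..hi d}"])
      show "h i x \<in> {lo d..hi d}" if "x \<in> {lo 0..hi 0}" for i x
        using mono[OF that, of i] range[of i] by auto
      show "\<bar>h i x - h i y\<bar> \<le> len (X i)" if "x \<in> {lo 0..hi 0}" "y \<in> {lo 0..hi 0}" for i x y
        using mono[OF that(1), of i] mono[OF that(2), of i] lenh[of i] by linarith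
    qed (use h0 hS C C0 eD \<beta> word_mem has_deriv deriv_pos in auto)
    then obtain h' where h': "\<And>x. (h n has_real_derivative h' x) (at x)" "\<And>x. 0 < h' x"
      and ratio: "\<And>x y. x \<in> {lo 0..hi 0} \<Longrightarrow> y \<in> {lo 0..hi 0} \<Longrightarrow>
        h' x \<le> h' y * exp (C * (\<Sum>i<n. len (X i) powr \<beta>))" by blast
    have "(\<Sum>i<n. len (X i) powr \<beta>) \<le> (\<Sum>i\<in>insert 0 {1..Q}. len (X i) powr \<beta>)"
      using n by (intro sum_mono2) auto
    also have "\<dots> = l0 + (\<Sum>i=1..Q. len (X i) powr \<beta>)"
      using lenh[of 0] by (simp add: h0 l0_def)
    also have "\<dots> \<le> l0 + K" using sum by (simp add: X_def)
    finally have "exp (C * (\<Sum>i<n. len (X i) powr \<beta>)) \<le> exp (C * (l0 + K))"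
      using C0 by (simp add: mult_left_mono)
    then have "h' x \<le> h' y * exp (C * (l0 + K))" if "x \<in> {lo 0..hi 0}" "y \<in> {lo 0..hi 0}" for x y
      using ratio[OF that] h'(2)[of y] by (meson less_imp_le mult_left_mono order_trans)
    then have "\<exists>h'. (\<forall>x. (h n has_real_derivative h' x) (at x) \<and> 0 < h' x) \<and>
        (\<forall>x\<in>{lo 0..hi 0}. \<forall>y\<in>{lo 0..hi 0}. h' x \<le> h' y * exp (C * (l0 + K)))"
      using h' by blast
    then show ?thesis
      using hG[of n] range[of n] lenh[of n] lenn by (intro bexI[of _ "h n"] conjI) simp_all
  qed
  moreover have "1 \<le> exp (C * (l0 + K))" using C0 K by (simp add: l0_def)
  ultimately show ?thesis by blast
qed

text \<open>An iterate of \<open>gen 0\<close> strongly shrinks the interval from \<open>x\<close>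
  to \<open>gen 0 x\<close>. A map \<open>h\<close> of bounded distortion that commutes with it on
  \<open>F\<close> carries this contraction into a tiny interval, where the iterate has derivative
  near 1 because it fixes both ends.\<close>

lemma no_displaced_point:
  assumes xF: "x \<in> F" and x: "lo 0 < x" "x < hi 0" and gx: "x < gen 0 x"
  shows False
proof -
  let ?f = "gen 0"
  let ?I = "{lo 0..hi 0}"
  obtain d where "2 / \<beta> < real d" using reals_Archimedean2 by blast
  then have "2 \<le> real d * \<beta>" using \<beta> by (simp add: field_simps)
  then obtain E where E: "1 \<le> E" and small: "\<And>\<delta>. 0 < \<delta> \<Longrightarrow>
    \<exists>h\<in>G. lo d \<le> h (lo 0) \<and> h (hi 0) \<le> hi d \<and> h (hi 0) - h (lo 0) < \<delta> \<and>
    (\<exists>h'. (\<forall>x. (h has_real_derivative h' x) (at x) \<and> 0 < h' x) \<and>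
      (\<forall>x\<in>?I. \<forall>y\<in>?I. h' x \<le> h' y * E))"
    using bounded_distortion_words by blast
  have orbit: "lo 0 < (?f ^^ k) x \<and> (?f ^^ k) x < hi 0" for k
    using funpow_gen_fixes[of 0 0 k] less_iff[OF funpow_mem[OF gen_mem[of 0], of k], of "lo 0" x]
      less_iff[OF funpow_mem[OF gen_mem[of 0], of k], of x "hi 0"] x by simp
  define p where "p k = (?f ^^ k) x" for k
  have inc: "incseq p" unfolding p_def using gx by (intro funpow_increasing gen_mem) simp
  \<comment> \<open>The increments of a bounded monotone orbit tend to 0. In \<open>2 * E\<close>,
    the factor \<open>E\<close> pays for the distortion of \<open>h\<close>, and 2 is matched by the
    lower bound 1/2 for the derivative.\<close>
  have "\<exists>k. p (Suc k) - p k < (?f x - x) / (2 * E)"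
  proof -
    have "\<forall>k. p k \<le> hi 0" using orbit by (simp add: p_def less_imp_le)
    then obtain L where "p \<longlonglongrightarrow> L"
      using incseq_convergent[OF inc, of "hi 0"] by blast
    then have "(\<lambda>k. p (Suc k) - p k) \<longlonglongrightarrow> L - L" by (intro tendsto_diff LIMSEQ_Suc)
    moreover have "0 < (?f x - x) / (2 * E)" using gx E by simp
    ultimately have "\<forall>\<^sub>F k in sequentially. p (Suc k) - p k < (?f x - x) / (2 * E)"
      by (intro order_tendstoD(2)) auto
    then show ?thesis by (auto simp: eventually_sequentially)
  qed
  then obtain k where k: "p (Suc k) - p k < (?f x - x) / (2 * E)" by blast
  let ?g = "?f ^^ k"
  have g: "?g \<in> G" by (intro funpow_mem gen_mem)
  \<comment> \<open>The \<open>\<delta>\<close> obtained here depends on \<open>k\<close>, and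
    \<open>k\<close> on \<open>E\<close>; this is consistent because \<open>E\<close> is uniform in
    \<open>\<delta>\<close>.\<close>
  have "uniformly_continuous_on {lo d..hi d} (deriv ?g)"
    using continuous_deriv[OF g] by (intro compact_uniformly_continuous) (auto intro: continuous_on_subset)
  then obtain \<delta> where \<delta>: "0 < \<delta>" "\<And>y z. y \<in> {lo d..hi d} \<Longrightarrow> z \<in> {lo d..hi d} \<Longrightarrow> \<bar>y - z\<bar> < \<delta> \<Longrightarrow>
      \<bar>deriv ?g y - deriv ?g z\<bar> < 1 / 2"
    unfolding uniformly_continuous_on_def dist_real_def by (metis half_gt_zero zero_less_one)
  obtain h h' where h: "h \<in> G" "lo d \<le> h (lo 0)" "h (hi 0) \<le> hi d" "h (hi 0) - h (lo 0) < \<delta>"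
    and h': "\<And>x. (h has_real_derivative h' x) (at x)" "\<And>x. 0 < h' x"
    and ratio: "\<And>x y. x \<in> ?I \<Longrightarrow> y \<in> ?I \<Longrightarrow> h' x \<le> h' y * E"
    using small[OF \<delta>(1)] by blast
  have h_mono: "h (lo 0) \<le> h y" "h y \<le> h (hi 0)" if "y \<in> ?I" for y
    using that by (auto simp: le_iff[OF h(1)])
  have p0: "p 0 = x" "p 1 = ?f x" by (auto simp: p_def)
  have pI: "p m \<in> ?I" for m using orbit[of m] by (simp add: p_def)
  have pF: "p m \<in> F" for m
    unfolding p_def by (rule F_inv[OF funpow_mem[OF gen_mem] xF])
  have p_less: "p m < p (Suc m)" for m
    using less_iff[OF funpow_mem[OF gen_mem[of 0], of m], of x "?f x"] gx
    by (simp add: p_def funpow_swap1)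
  have gp: "?g (h (p m)) = h (p (k + m))" for m
    using comm[OF g h(1) pF[of m]] by (simp add: p_def funpow_add)
  have MVT_h: "\<exists>\<xi>\<in>?I. h (p (Suc m)) - h (p m) = (p (Suc m) - p m) * h' \<xi>" for m
    using MVT2[OF p_less[of m], of h h'] h'(1) pI[of m] pI[of "Suc m"] by force
  obtain \<xi> where \<xi>: "\<xi> \<in> ?I" "h (p 1) - h (p 0) = (p 1 - p 0) * h' \<xi>"
    using MVT_h[of 0] by auto
  obtain \<eta> where \<eta>: "\<eta> \<in> ?I" "h (p (Suc k)) - h (p k) = (p (Suc k) - p k) * h' \<eta>"
    using MVT_h[of k] by auto
  have "h (p (Suc k)) - h (p k) \<le> (p (Suc k) - p k) * (h' \<xi> * E)"
    using \<eta>(2) ratio[OF \<eta>(1) \<xi>(1)] p_less[of k] by (simp add: mult_left_mono)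
  also have "\<dots> < (p 1 - p 0) / (2 * E) * (h' \<xi> * E)"
    using k h'(2)[of \<xi>] E by (intro mult_strict_right_mono) (auto simp: p0 simp del: One_nat_def)
  also have "\<dots> = (h (p 1) - h (p 0)) / 2" using \<xi>(2) E by simp
  finally have upper: "h (p (Suc k)) - h (p k) < (h (p 1) - h (p 0)) / 2" .
  have "h (p 0) < h (p 1)" using p_less[of 0] less_iff[OF h(1)] by simp
  then obtain \<zeta> where \<zeta>: "h (p 0) < \<zeta>" "\<zeta> < h (p 1)"
      "?g (h (p 1)) - ?g (h (p 0)) = (h (p 1) - h (p 0)) * deriv ?g \<zeta>"
    using MVT2[of "h (p 0)" "h (p 1)" ?g "deriv ?g"] has_deriv[OF g] by auto
  have "h (lo 0) < h (hi 0)" using lo_less_hi[of 0] less_iff[OF h(1)] by simp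
  then obtain \<omega> where \<omega>: "h (lo 0) < \<omega>" "\<omega> < h (hi 0)"
      "?g (h (hi 0)) - ?g (h (lo 0)) = (h (hi 0) - h (lo 0)) * deriv ?g \<omega>"
    using MVT2[of "h (lo 0)" "h (hi 0)" ?g "deriv ?g"] has_deriv[OF g] by auto
  \<comment> \<open>Commutation makes the ends of the small interval fixed by \<open>?g\<close>, so
    the mean slope \<open>deriv ?g \<omega>\<close> is 1.\<close>
  have "?g (h (lo 0)) = h (lo 0)" "?g (h (hi 0)) = h (hi 0)"
    using comm[OF g h(1) lo_in_F[of 0]] comm[OF g h(1) hi_in_F[of 0]] funpow_gen_fixes[of 0 0 k] by auto
  then have \<omega>1: "deriv ?g \<omega> = 1" using \<omega> \<open>h (lo 0) < h (hi 0)\<close> by simp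
  have \<zeta>r: "h (lo 0) < \<zeta>" "\<zeta> < h (hi 0)"
    using \<zeta> h_mono[OF pI[of 0]] h_mono[OF pI[of 1]] by auto
  then have "\<bar>\<zeta> - \<omega>\<bar> < \<delta>" using \<omega> h(4) by linarith
  then have "\<bar>deriv ?g \<zeta> - deriv ?g \<omega>\<bar> < 1 / 2"
    using \<zeta>r \<omega> h(2,3) by (intro \<delta>(2)) auto
  then have "1 / 2 < deriv ?g \<zeta>" using \<omega>1 by linarith
  then have "(h (p 1) - h (p 0)) * (1 / 2) < ?g (h (p 1)) - ?g (h (p 0))"
    unfolding \<zeta>(3) using \<open>h (p 0) < h (p 1)\<close> by (intro mult_strict_left_mono) auto
  then show False using upper gp[of 0] gp[of 1] by simp
qed

end

section \<open>Contradiction in the case of fixed points without a common one\<close>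

locale smooth_abelian_level = abelian_level + smooth_line_group
begin

lemma inconsistent: False
proof -
  obtain x where xF: "x \<in> F" using F_ne by blast
  obtain g where g: "g \<in> G" "g x \<noteq> x" using no_global by blast
  have "\<exists>g\<in>G. x < g x"
  proof (cases "x < g x")
    case False
    then have "x < finv g x" using g by (simp add: less_inv_iff)
    then show ?thesis using inv_mem[OF g(1)] by blast
  qed (use g in blast)
  then obtain g where g: "g \<in> G" "x < g x" by blast
  then obtain a b where ab: "adj g a b" "a < x" "x < b" using adj_exists[OF g(1) xF] by auto
  \<comment> \<open>Dependent choice builds the chain; the clause for \<open>n = 0\<close> records
    that the first element moves \<open>x\<close> inside its gap.\<close>
  define P where "P n s = (case s of (g, a, b) \<Rightarrow> g \<in> G \<and> adj g a b \<and> (n = 0 \<longrightarrow> g x > x \<and> a < x \<and> x < b))"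
    for n :: nat and s :: "(real \<Rightarrow> real) \<times> real \<times> real"
  define R where "R s t = (case s of (g, a, b) \<Rightarrow> case t of (g', a', b') \<Rightarrow> b < g' b \<and> a' < b \<and> b < b')"
    for s t :: "(real \<Rightarrow> real) \<times> real \<times> real"
  have "\<exists>s. \<forall>n. P n (s n) \<and> R (s n) (s (Suc n))"
  proof (rule dependent_nat_choice)
    show "\<exists>s. P 0 s" using g ab by (intro exI[of _ "(g, a, b)"]) (auto simp: P_def)
    fix s n assume "P n s"
    then obtain g a b where s: "s = (g, a, b)" "g \<in> G" "adj g a b" by (auto simp: P_def)
    obtain g' a' b' where "g' \<in> G" "adj g' a' b'" "b < g' b" "a' < b" "b < b'"
      using adj_step[OF s(3,2)] by blast
    then show "\<exists>t. P (Suc n) t \<and> R s t"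
      by (intro exI[of _ "(g', a', b')"]) (auto simp: P_def R_def s(1))
  qed
  then obtain s where s: "\<And>n. P n (s n)" "\<And>n. R (s n) (s (Suc n))" by blast
  define gen lo hi where "gen n = fst (s n)" and "lo n = fst (snd (s n))" and "hi n = snd (snd (s n))" for n
  interpret smooth_level_chain G F gen lo hi \<beta>
  proof
    fix n
    show "gen n \<in> G" "adj (gen n) (lo n) (hi n)"
      using s(1)[of n] by (auto simp: P_def gen_def lo_def hi_def split: prod.splits)
    show "hi n < gen (Suc n) (hi n)" "lo (Suc n) < hi n" "hi n < hi (Suc n)"
      using s(2)[of n] by (auto simp: R_def gen_def lo_def hi_def split: prod.splits)
  qed
  have "lo 0 < x" "x < hi 0" "x < gen 0 x"
    using s(1)[of 0] by (auto simp: P_def gen_def lo_def hi_def split: prod.splits)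
  then show False using no_displaced_point[OF xF] by blast
qed

end

section \<open>The three cases: a common fixed point, a free element, neither\<close>

theorem theorem1p4:
  fixes \<alpha> :: real and G :: "(real \<Rightarrow> real) set"
  assumes "\<alpha> > 0"
    and "subgroup G Homeo_plus"
    and "nilpotent_group (Homeo_plus\<lparr>carrier := G\<rparr>)"
    and "\<forall>g\<in>G. class_C_1_plus \<alpha> g"
  shows "(\<exists>\<mu>. Radon_measure \<mu> \<and> emeasure \<mu> UNIV \<noteq> 0 \<and> invariant_measure G \<mu>) \<and>
         (\<exists>K. minimal_closed_invariant G K)"
proof -
  interpret nilpotent_line_group G by (intro nilpotent_line_group.intro line_subgroup.intro nilpotent_line_group_axioms.intro assms)
  consider (fixed) p where "\<And>g. g \<in> G \<Longrightarrow> g p = p"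
    | (free) g where "g \<in> G" "\<And>x. g x \<noteq> x"
    | (none) "\<And>x. \<exists>g\<in>G. g x \<noteq> x" "\<And>g. g \<in> G \<Longrightarrow> \<exists>x. g x = x"
    by blast
  then show ?thesis
  proof cases
    case fixed
    then show ?thesis by (intro conjI conclusion_if_global_fixed_point)
  next
    case free
    then show ?thesis by (intro conjI conclusion_if_free_element)
  next
    case none
    obtain H F where H: "H \<subseteq> G" "line_group H" "\<forall>x. \<exists>g\<in>H. g x \<noteq> x" and F: "closed F" "F \<noteq> {}"
        "\<forall>g\<in>H. \<forall>x\<in>F. g x \<in> F" "\<forall>g\<in>H. \<forall>h\<in>H. \<forall>x\<in>F. g (h x) = h (g x)"
      using central_level[OF none(1)] by blast
    have C: "class_C_1_plus \<alpha> g" if "g \<in> H" for g using that H(1) assms(4) by blast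
    interpret H: line_group H by (rule H(2))
    interpret H: smooth_abelian_level H F "min \<alpha> 1"
    proof
      show "0 < min \<alpha> 1" using assms(1) by simp
      show "g x \<in> F" if "g \<in> H" "x \<in> F" for g x using F(3) that by blast
      show "g (h x) = h (g x)" if "g \<in> H" "h \<in> H" "x \<in> F" for g h x using F(4) that by blast
      show "\<exists>g\<in>H. g x \<noteq> x" for x using H(3) by blast
      show "\<exists>x. g x = x" if "g \<in> H" for g using none(2) H(1) that by blast
      show "(g has_real_derivative deriv g x) (at x)" "continuous_on UNIV (deriv g)"
        "locally_Hoelder (min \<alpha> 1) (deriv g)" if "g \<in> H" for g x
        using class_C_1_plus_regular[OF C[OF that]] by blast+
    qed (use F in auto)
    show ?thesis using H.inconsistent by blast
  qed
qed

end
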